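(* Let $n\in\mathbb{N}$ with $n\geq 3$, let $B_n(\mathbb{S}^2)$ denote the $n$-string braid group of the sphere $\mathbb{S}^2$, let $\Gamma_2\left(B_n(\mathbb{S}^2)\right)$ denote its commutator subgroup, and let $\mathcal{Q}_8$ denote the quaternion group of order $8$. (a) If $n$ is a multiple of $4$, then $\Gamma_2\left(B_n(\mathbb{S}^2)\right)$ contains a subgroup isomorphic to $\mathcal{Q}_8$. (b) If $n$ is an odd multiple of $2$, then $B_n(\mathbb{S}^2)$ contains a subgroup isomorphic to $\mathcal{Q}_8$. (c) If $n$ is odd, then $B_n(\mathbb{S}^2)$ contains no subgroup isomorphic to $\mathcal{Q}_8$.
   Context: The sphere braid group $B_n(\mathbb{S}^2)$ is the fundamental group of the configuration space of $n$ unordered distinct points of $\mathbb{S}^2$. It is the group generated by $\sigma_1,\ldots,\sigma_{n-1}$ subject to the following relations: $\sigma_i\sigma_j=\sigma_j\sigma_i$ if $|i-j|\geq 2$ and $1\leq i,j\leq n-1$; $\sigma_i\sigma_{i+1}\sigma_i=\sigma_{i+1}\sigma_i\sigma_{i+1}$ for all $1\leq i\leq n-2$; and $\sigma_1\cdots\sigma_{n-2}\sigma_{n-1}^2\sigma_{n-2}\cdots\sigma_1=1$. The commutator subgroup $\Gamma_2\left(B_n(\mathbb{S}^2)\right)$ is the subgroup generated by all commutators of elements of $B_n(\mathbb{S}^2)$. *)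

theory Defs
  imports "HOL-Algebra.Generated_Groups"
begin

section \<open>Groups given by generators and relations\<close>

text \<open>The letter \<open>(x, True)\<close> stands for the generator \<open>x\<close>, and \<open>(x, False)\<close> for its inverse.\<close>

type_synonym 'a word = "('a \<times> bool) list"

definition words :: "'a set \<Rightarrow> 'a word set" where
  "words X = lists (X \<times> UNIV)"

text \<open>The smallest congruence on the monoid of words over \<open>X\<close> and its formal inverses that
  identifies the two sides of every relation in \<open>R\<close> and cancels adjacent inverse letters.\<close>

inductive_set pres_rel :: "'a set \<Rightarrow> ('a word \<times> 'a word) set \<Rightarrow> ('a word \<times> 'a word) set"
  for X :: "'a set" and R :: "('a word \<times> 'a word) set" where
  rel: "(u, v) \<in> R \<Longrightarrow> u \<in> words X \<Longrightarrow> v \<in> words X \<Longrightarrow> (u, v) \<in> pres_rel X R"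
| cancel: "x \<in> X \<Longrightarrow> ([(x, b), (x, \<not> b)], []) \<in> pres_rel X R"
| refl: "u \<in> words X \<Longrightarrow> (u, u) \<in> pres_rel X R"
| sym: "(u, v) \<in> pres_rel X R \<Longrightarrow> (v, u) \<in> pres_rel X R"
| trans: "(u, v) \<in> pres_rel X R \<Longrightarrow> (v, w) \<in> pres_rel X R \<Longrightarrow> (u, w) \<in> pres_rel X R"
| mult: "(u, u') \<in> pres_rel X R \<Longrightarrow> (v, v') \<in> pres_rel X R \<Longrightarrow> (u @ v, u' @ v') \<in> pres_rel X R"

definition presented_group :: "'a set \<Rightarrow> ('a word \<times> 'a word) set \<Rightarrow> 'a word set monoid" where
  "presented_group X R =
     \<lparr>carrier = words X // pres_rel X R,
      mult = (\<lambda>A B. \<Union>u\<in>A. \<Union>v\<in>B. pres_rel X R `` {u @ v}),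
      one = pres_rel X R `` {[]}\<rparr>"

lemma words_append [simp]: "u @ v \<in> words X \<longleftrightarrow> u \<in> words X \<and> v \<in> words X"
  and words_Nil [simp]: "[] \<in> words X"
  and words_Cons [simp]: "(x, b) # u \<in> words X \<longleftrightarrow> x \<in> X \<and> u \<in> words X"
  by (auto simp: words_def)

lemma pres_rel_words:
  assumes "(u, v) \<in> pres_rel X R"
  shows "u \<in> words X \<and> v \<in> words X"
  using assms by induction auto

lemma equiv_pres_rel: "equiv (words X) (pres_rel X R)"
proof (rule equivI)
  show "pres_rel X R \<subseteq> words X \<times> words X"
    using pres_rel_words by fast
  show "refl_on (words X) (pres_rel X R)"
    by (simp add: refl_on_def pres_rel.refl)
  show "sym (pres_rel X R)"
    by (meson symI pres_rel.sym)
  show "trans (pres_rel X R)"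
    by (meson transI pres_rel.trans)
qed

lemma pres_class_eq_iff:
  assumes "u \<in> words X" "v \<in> words X"
  shows "pres_rel X R `` {u} = pres_rel X R `` {v} \<longleftrightarrow> (u, v) \<in> pres_rel X R"
  using eq_equiv_class_iff[OF equiv_pres_rel assms] .

lemma presented_group_mult:
  assumes "u \<in> words X" "v \<in> words X"
  shows "pres_rel X R `` {u} \<otimes>\<^bsub>presented_group X R\<^esub> pres_rel X R `` {v} = pres_rel X R `` {u @ v}"
proof -
  have "pres_rel X R `` {u' @ v'} = pres_rel X R `` {u @ v}"
    if "(u, u') \<in> pres_rel X R" "(v, v') \<in> pres_rel X R" for u' v'
    using equiv_class_eq[OF equiv_pres_rel pres_rel.mult[OF that]] by simp
  then have "(\<Union>u'\<in>pres_rel X R `` {u}. \<Union>v'\<in>pres_rel X R `` {v}. pres_rel X R `` {u' @ v'})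
      = (\<Union>u'\<in>pres_rel X R `` {u}. \<Union>v'\<in>pres_rel X R `` {v}. pres_rel X R `` {u @ v})"
    by simp
  moreover have "u \<in> pres_rel X R `` {u}" "v \<in> pres_rel X R `` {v}"
    using assms by (simp_all add: pres_rel.refl)
  ultimately show ?thesis
    unfolding presented_group_def by (simp del: Image_singleton_iff) blast
qed

lemma presented_group_carrier_cases:
  assumes "A \<in> carrier (presented_group X R)"
  obtains u where "u \<in> words X" "A = pres_rel X R `` {u}"
  using assms quotientE[of A "words X" "pres_rel X R"] by (metis partial_object.simps(1) presented_group_def)

lemma presented_group_class_closed:
  "u \<in> words X \<Longrightarrow> pres_rel X R `` {u} \<in> carrier (presented_group X R)"
  by (simp add: presented_group_def quotientI)

lemma presented_group_one:
  "\<one>\<^bsub>presented_group X R\<^esub> = pres_rel X R `` {[]}"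
  by (simp add: presented_group_def)

definition inv_word :: "'a word \<Rightarrow> 'a word" where
  "inv_word u = rev (map (\<lambda>(x, b). (x, \<not> b)) u)"

lemma inv_word_words [simp]: "u \<in> words X \<Longrightarrow> inv_word u \<in> words X"
  by (induction u) (auto simp: inv_word_def)

lemma inv_word_cancel:
  assumes "u \<in> words X"
  shows "(inv_word u @ u, []) \<in> pres_rel X R"
  using assms
proof (induction u)
  case Nil
  then show ?case by (simp add: inv_word_def pres_rel.refl)
next
  case (Cons a u)
  obtain x b where a: "a = (x, b)" by fastforce
  have x: "x \<in> X" and u: "u \<in> words X" using Cons.prems a by auto
  have "([(x, \<not> b), (x, b)] @ u, [] @ u) \<in> pres_rel X R"
    using pres_rel.mult[OF pres_rel.cancel[OF x, of "\<not> b" R] pres_rel.refl[OF u]] by simp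
  from pres_rel.mult[OF pres_rel.refl[OF inv_word_words[OF u]] this]
  have "(inv_word (a # u) @ a # u, inv_word u @ u) \<in> pres_rel X R"
    by (simp add: inv_word_def a)
  then show ?case using Cons.IH[OF u] pres_rel.trans by blast
qed

lemma group_presented_group: "group (presented_group X R)"
proof (rule groupI)
  fix A assume "A \<in> carrier (presented_group X R)"
  then obtain u where u: "u \<in> words X" "A = pres_rel X R `` {u}"
    by (rule presented_group_carrier_cases)
  show "\<one>\<^bsub>presented_group X R\<^esub> \<otimes>\<^bsub>presented_group X R\<^esub> A = A"
    using u by (simp add: presented_group_one presented_group_mult)
  have "pres_rel X R `` {inv_word u} \<otimes>\<^bsub>presented_group X R\<^esub> A = \<one>\<^bsub>presented_group X R\<^esub>"
    using u by (simp add: presented_group_one presented_group_mult pres_class_eq_iff inv_word_cancel)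
  then show "\<exists>B\<in>carrier (presented_group X R). B \<otimes>\<^bsub>presented_group X R\<^esub> A = \<one>\<^bsub>presented_group X R\<^esub>"
    using u presented_group_class_closed inv_word_words by blast
next
  fix A B C
  assume "A \<in> carrier (presented_group X R)" "B \<in> carrier (presented_group X R)"
    "C \<in> carrier (presented_group X R)"
  then show "A \<otimes>\<^bsub>presented_group X R\<^esub> B \<otimes>\<^bsub>presented_group X R\<^esub> C =
      A \<otimes>\<^bsub>presented_group X R\<^esub> (B \<otimes>\<^bsub>presented_group X R\<^esub> C)"
    by (elim presented_group_carrier_cases) (simp add: presented_group_mult)
next
  fix A B
  assume "A \<in> carrier (presented_group X R)" "B \<in> carrier (presented_group X R)"
  then show "A \<otimes>\<^bsub>presented_group X R\<^esub> B \<in> carrier (presented_group X R)"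
    by (elim presented_group_carrier_cases)
      (simp add: presented_group_mult presented_group_class_closed)
qed (simp add: presented_group_one presented_group_class_closed)

fun eval_word :: "('b, 'c) monoid_scheme \<Rightarrow> ('a \<Rightarrow> 'b) \<Rightarrow> 'a word \<Rightarrow> 'b" where
  "eval_word H f [] = \<one>\<^bsub>H\<^esub>"
| "eval_word H f ((x, b) # u) = (if b then f x else inv\<^bsub>H\<^esub> (f x)) \<otimes>\<^bsub>H\<^esub> eval_word H f u"

text \<open>The universal property: relation-respecting assignments of the generators extend to
  homomorphisms.\<close>

lemma presented_group_universal:
  assumes "group H" and f: "\<And>x. x \<in> X \<Longrightarrow> f x \<in> carrier H"
    and R: "\<And>u v. (u, v) \<in> R \<Longrightarrow> u \<in> words X \<Longrightarrow> v \<in> words X \<Longrightarrow> eval_word H f u = eval_word H f v"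
  obtains h where "h \<in> hom (presented_group X R) H"
    and "\<And>u. u \<in> words X \<Longrightarrow> h (pres_rel X R `` {u}) = eval_word H f u"
proof -
  interpret H: group H by fact
  have closed: "eval_word H f u \<in> carrier H" if "u \<in> words X" for u
    using that by (induction u) (auto simp: f)
  have app: "eval_word H f (u @ v) = eval_word H f u \<otimes>\<^bsub>H\<^esub> eval_word H f v"
    if "u \<in> words X" "v \<in> words X" for u v
    using that by (induction u) (auto simp: f closed H.m_assoc)
  have resp: "eval_word H f u = eval_word H f v" if "(u, v) \<in> pres_rel X R" for u v
    using that
  proof induction
    case (mult u u' v v')
    then show ?case by (simp add: app pres_rel_words)
  qed (auto simp: R f)
  define h where "h A = eval_word H f (SOME u. u \<in> A)" for A
  have h: "h (pres_rel X R `` {u}) = eval_word H f u" if "u \<in> words X" for u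
  proof -
    have "(SOME v. v \<in> pres_rel X R `` {u}) \<in> pres_rel X R `` {u}"
      by (rule someI[of _ u]) (simp add: pres_rel.refl that)
    then show ?thesis unfolding h_def using resp by auto
  qed
  have "h \<in> hom (presented_group X R) H"
  proof (rule homI)
    fix A assume "A \<in> carrier (presented_group X R)"
    then show "h A \<in> carrier H"
      by (elim presented_group_carrier_cases) (simp add: h closed)
  next
    fix A B assume "A \<in> carrier (presented_group X R)" "B \<in> carrier (presented_group X R)"
    then show "h (A \<otimes>\<^bsub>presented_group X R\<^esub> B) = h A \<otimes>\<^bsub>H\<^esub> h B"
      by (elim presented_group_carrier_cases) (simp add: h presented_group_mult app)
  qed
  then show ?thesis using h that by blast
qed


section \<open>The sphere braid groups\<close>

definition pos_word :: "nat list \<Rightarrow> nat word" where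
  "pos_word is = map (\<lambda>i. (i, True)) is"

definition sphere_braid_relations :: "nat \<Rightarrow> (nat word \<times> nat word) set" where
  "sphere_braid_relations n =
     {(pos_word [i, j], pos_word [j, i]) | i j.
        i \<in> {1..n - 1} \<and> j \<in> {1..n - 1} \<and> \<bar>int i - int j\<bar> \<ge> 2} \<union>
     {(pos_word [i, i + 1, i], pos_word [i + 1, i, i + 1]) | i. i \<in> {1..n - 2}} \<union>
     {(pos_word ([1..<n - 1] @ [n - 1, n - 1] @ rev [1..<n - 1]), [])}"

text \<open>The fundamental group of the space of \<open>n\<close>-point subsets of the sphere, given by the
  Fadell--Van Buskirk presentation. The definition is meant for \<open>n \<ge> 2\<close>.\<close>

definition sphere_braid_group :: "nat \<Rightarrow> nat word set monoid" where
  "sphere_braid_group n = presented_group {1..n - 1} (sphere_braid_relations n)"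

lemma group_sphere_braid_group: "group (sphere_braid_group n)"
  by (simp add: sphere_braid_group_def group_presented_group)

text \<open>The group \<open>\<Gamma>\<^sub>2(G)\<close>; \<^const>\<open>derived\<close> is the subgroup generated by the commutators.\<close>

definition commutator_subgroup :: "('a, 'b) monoid_scheme \<Rightarrow> ('a, 'b) monoid_scheme" where
  "commutator_subgroup G = G\<lparr>carrier := derived G (carrier G)\<rparr>"

lemma (in group) group_commutator_subgroup: "group (commutator_subgroup G)"
  unfolding commutator_subgroup_def
  using subgroup_imp_group[OF derived_is_subgroup[OF order_refl]] .


section \<open>The quaternion group of order 8\<close>

text \<open>\<open>(a, b, c, d)\<close> stands for the quaternion \<open>a + bi + cj + dk\<close>.\<close>

type_synonym quat = "int \<times> int \<times> int \<times> int"

fun quat_mult :: "quat \<Rightarrow> quat \<Rightarrow> quat" where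
  "quat_mult (a, b, c, d) (a', b', c', d') =
     (a * a' - b * b' - c * c' - d * d',
      a * b' + b * a' + c * d' - d * c',
      a * c' - b * d' + c * a' + d * b',
      a * d' + b * c' - c * b' + d * a')"

definition Q8 :: "quat monoid" where
  "Q8 = \<lparr>carrier = {(1, 0, 0, 0), (-1, 0, 0, 0), (0, 1, 0, 0), (0, -1, 0, 0),
                   (0, 0, 1, 0), (0, 0, -1, 0), (0, 0, 0, 1), (0, 0, 0, -1)},
         mult = quat_mult,
         one = (1, 0, 0, 0)\<rparr>"

lemma group_Q8: "group Q8"
proof (rule groupI)
  fix x assume "x \<in> carrier Q8"
  then show "\<exists>y\<in>carrier Q8. y \<otimes>\<^bsub>Q8\<^esub> x = \<one>\<^bsub>Q8\<^esub>"
    by (auto simp: Q8_def)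
next
  fix x y z :: quat
  show "x \<otimes>\<^bsub>Q8\<^esub> y \<otimes>\<^bsub>Q8\<^esub> z = x \<otimes>\<^bsub>Q8\<^esub> (y \<otimes>\<^bsub>Q8\<^esub> z)"
    by (cases x; cases y; cases z) (simp add: Q8_def algebra_simps)
next
  fix x y assume "x \<in> carrier Q8" "y \<in> carrier Q8"
  then show "x \<otimes>\<^bsub>Q8\<^esub> y \<in> carrier Q8"
    unfolding Q8_def by (simp only: partial_object.simps insert_iff empty_iff simp_thms)
      (elim disjE; simp)
next
  fix x assume "x \<in> carrier Q8"
  then show "\<one>\<^bsub>Q8\<^esub> \<otimes>\<^bsub>Q8\<^esub> x = x"
    by (cases x) (simp add: Q8_def)
qed (simp add: Q8_def)

lemma order_Q8: "order Q8 = 8"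
  by (simp add: Q8_def order_def)

definition contains_copy_of :: "('a, 'b) monoid_scheme \<Rightarrow> ('c, 'd) monoid_scheme \<Rightarrow> bool" where
  "contains_copy_of G K \<longleftrightarrow> (\<exists>H. subgroup H G \<and> G\<lparr>carrier := H\<rparr> \<cong> K)"

end

theory Submission
  imports Defs
begin

text \<open>Write \<open>n = m + 1\<close>, let \<open>\<alpha> = \<sigma>\<^sub>1 \<dots> \<sigma>\<^sub>m\<close>, and let \<open>\<Delta>\<close> be the half twist on \<open>n\<close> strings.

\<^emph>\<open>The copies of the quaternion group.\<close> Conjugation by \<open>\<Delta>\<close> sends \<open>\<sigma>\<^sub>i\<close> to \<open>\<sigma>\<^bsub>n-i\<^esub>\<close>, so it sends \<open>\<alpha>\<close> to the
reversed word, which the sphere relation makes equal to \<open>\<alpha>\<close> inverse. Moreover \<open>\<Delta>\<^sup>2 = \<alpha>\<^sup>n\<close>. If \<open>n\<close>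
is even, then \<open>x\<close>, the power of \<open>\<alpha>\<close> to the \<open>n/2\<close>, and \<open>y = \<Delta>\<close> therefore satisfy \<open>x\<^sup>2 = y\<^sup>2\<close> and \<open>x y x = y\<close>,
and two such elements generate a copy of \<open>Q8\<close> as soon as \<open>x\<^sup>2\<close> is not trivial
(\<open>quaternion_pair\<close>, \<open>contains_Q8I\<close>). Both have \<open>n m / 2\<close> letters. The abelianization is cyclic of order
dividing \<open>2 m\<close>, generated by the common class of the \<open>\<sigma>\<^sub>i\<close>, so for \<open>4\<close> dividing \<open>n\<close> both lie in the
commutator subgroup (\<open>sphere_class_in_derived\<close>).

\<^emph>\<open>When is a sphere braid trivial?\<close> Both \<open>\<Delta>\<^sup>2 \<noteq> 1\<close> and the case of odd \<open>n\<close> need an answer. A sphere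
braid one of whose strings starts and ends at the same place can be read as a planar braid of the other \<open>m\<close>
strings, by placing that string at infinity. The only ambiguity comes from sliding strings across the point at
infinity: the stabilizer of a position is the planar braid group on \<open>m\<close> strings modulo the central element
\<open>\<Phi> = e\<^sub>1 \<dots> e\<^sub>m\<close>, where in \<open>e\<^sub>k\<close> the \<open>k\<close>th string runs once around all the others. To prove this from
the presentation, the generators are made to act on pairs of a position of the marked string and an element of
this quotient (\<open>act\<close>), and the defining relations of the sphere braid group are checked. Left multiplication
in the sphere braid group matches this action under \<open>(k, q) \<mapsto> \<rho> k \<psi>(q)\<close> (\<open>sphere_action\<close>), so a sphere braid fixing
one of these pairs is trivial.

\<^emph>\<open>Nontriviality.\<close> In the sphere braid group \<open>\<Delta>\<^sup>2\<close> equals the full twist on the first \<open>m\<close> strings. A positive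
word that is trivial modulo \<open>\<Phi>\<close> has length a multiple of \<open>2 m (m - 1)\<close>, the length of \<open>\<Phi>\<close>, but this full
twist has length \<open>m (m - 1)\<close> (\<open>planar_class_half_twist_square\<close>).

\<^emph>\<open>Odd \<open>n\<close>.\<close> A group of order \<open>8\<close> permuting an odd number of positions fixes one of them, so the generators
\<open>x\<close>, \<open>y\<close> of a quaternion subgroup act on pairs above that position as left multiplication by some \<open>p\<close>, \<open>q\<close>
with \<open>p q p = q\<close> and \<open>p\<^sup>4 = 1\<close> modulo \<open>\<Phi>\<close>. Lift \<open>p\<close> and \<open>q\<close> to positive braids.
Comparing lengths in these two equations shows that \<open>p\<^sup>4\<close> is the square of a power of \<open>\<Phi>\<close>. Since \<open>\<Phi>\<close> is
central and commuting positive braids with equal squares are equal (\<open>square_root_unique\<close>), \<open>p\<^sup>2\<close> is a power of \<open>\<Phi>\<close>,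
hence trivial, and so \<open>x\<^sup>2 = 1\<close> (\<open>no_quaternion_subgroup\<close>).

\<^emph>\<open>Unique square roots\<close> come from Garside's theory of the positive braid monoid. It is cancellative and
any two elements with a common multiple have a least one; if \<open>l\<close> is the least common multiple of \<open>y\<close> and \<open>z\<close>, where
\<open>y\<^sup>2 = z\<^sup>2\<close> and \<open>y z = z y\<close>, then \<open>y l\<close> and \<open>z l\<close> are least common multiples of the same two elements
\<open>y\<^sup>2\<close> and \<open>y z\<close>, so \<open>y l = z l\<close>.\<close>

section \<open>The monoid of positive braids\<close>

definition far :: "nat \<Rightarrow> nat \<Rightarrow> bool" where
  "far i j \<longleftrightarrow> i + 2 \<le> j \<or> j + 2 \<le> i"

definition adj :: "nat \<Rightarrow> nat \<Rightarrow> bool" where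
  "adj i j \<longleftrightarrow> j = Suc i \<or> i = Suc j"

lemma far_sym: "far i j \<Longrightarrow> far j i" and adj_sym: "adj i j \<Longrightarrow> adj j i"
  by (auto simp: far_def adj_def)

lemma index_cases: obtains "i = j" | "far i j" | "adj i j"
  unfolding far_def adj_def by linarith

text \<open>Indices are unrestricted, so that no number of strings has to be fixed: both relations preserve the set of
letters, and a braid on \<open>m\<close> strings is one whose letters lie in \<open>{1..<m}\<close>.\<close>

inductive braid_eq :: "nat list \<Rightarrow> nat list \<Rightarrow> bool" where
  comm: "far i j \<Longrightarrow> braid_eq (x @ [i, j] @ y) (x @ [j, i] @ y)"
| braid: "adj i j \<Longrightarrow> braid_eq (x @ [i, j, i] @ y) (x @ [j, i, j] @ y)"
| refl: "braid_eq u u"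
| sym: "braid_eq u v \<Longrightarrow> braid_eq v u"
| trans: "braid_eq u v \<Longrightarrow> braid_eq v w \<Longrightarrow> braid_eq u w"

lemma braid_eq_context: "braid_eq u v \<Longrightarrow> braid_eq (a @ u @ b) (a @ v @ b)"
proof (induction rule: braid_eq.induct)
  case (comm i j x y)
  then show ?case using braid_eq.comm[of i j "a @ x" "y @ b"] by simp
next
  case (braid i j x y)
  then show ?case using braid_eq.braid[of i j "a @ x" "y @ b"] by simp
qed (auto intro: braid_eq.refl braid_eq.sym braid_eq.trans)

lemma braid_eq_append: "braid_eq u u' \<Longrightarrow> braid_eq v v' \<Longrightarrow> braid_eq (u @ v) (u' @ v')"
  using braid_eq_context[of u u' "[]" v] braid_eq_context[of v v' u' "[]"]
  by (auto intro: braid_eq.trans)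

lemma braid_eq_length: "braid_eq u v \<Longrightarrow> length u = length v"
  by (induction rule: braid_eq.induct) auto

lemma braid_eq_set: "braid_eq u v \<Longrightarrow> set u = set v"
  by (induction rule: braid_eq.induct) auto

lemma braid_eq_rev: "braid_eq u v \<Longrightarrow> braid_eq (rev u) (rev v)"
proof (induction rule: braid_eq.induct)
  case (comm i j x y)
  then show ?case using braid_eq.comm[of j i "rev y" "rev x"] by (simp add: far_sym)
next
  case (braid i j x y)
  then show ?case using braid_eq.braid[of i j "rev y" "rev x"] by simp
qed (auto intro: braid_eq.refl braid_eq.sym braid_eq.trans)

quotient_type posbraid = "nat list" / braid_eq
  by (rule equivpI) (auto intro!: reflpI sympI transpI intro: braid_eq.refl braid_eq.sym braid_eq.trans)

instantiation posbraid :: monoid_mult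
begin

lift_definition one_posbraid :: posbraid is "[]" .

lift_definition times_posbraid :: "posbraid \<Rightarrow> posbraid \<Rightarrow> posbraid" is "(@)"
  by (rule braid_eq_append)

instance
  by standard (transfer, simp add: braid_eq.refl)+

end

lift_definition br :: "nat list \<Rightarrow> posbraid" is "\<lambda>u. u" .

lift_definition len :: "posbraid \<Rightarrow> nat" is length
  by (rule braid_eq_length)

text \<open>The reversal anti-automorphism turns every statement about left multiples into one about right multiples.\<close>

lift_definition mirror :: "posbraid \<Rightarrow> posbraid" is rev
  by (rule braid_eq_rev)

lift_definition \<sigma> :: "nat \<Rightarrow> posbraid" is "\<lambda>i. [i]" .

lemma br_eq_iff: "br u = br v \<longleftrightarrow> braid_eq u v"
  by transfer simp

lemma br_append: "br (u @ v) = br u * br v"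
  by transfer (simp add: braid_eq.refl)

lemma br_Nil [simp]: "br [] = 1"
  by transfer (simp add: braid_eq.refl)

lemma br_Cons: "br (i # u) = \<sigma> i * br u"
  by transfer (simp add: braid_eq.refl)

lemma s_eq: "\<sigma> i = br [i]"
  by (simp add: br_Cons)

lemma br_surj: obtains u where "x = br u"
proof -
  have "\<exists>u. x = br u"
    by transfer (auto intro: braid_eq.refl)
  then show ?thesis using that by blast
qed

lemma len_simps [simp]: "len 1 = 0" "len (x * y) = len x + len y" "len (br u) = length u"
    "len (\<sigma> i) = 1"
  by (transfer, simp)+

lemma len_power [simp]: "len (x ^ k) = k * len x"
  by (induction k) auto

lemma mirror_simps [simp]: "mirror (br u) = br (rev u)" "mirror (\<sigma> i) = \<sigma> i" "mirror (x * y) = mirror y * mirror x"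
    "mirror (mirror x) = x" "mirror 1 = 1"
  by (transfer, simp add: braid_eq.refl)+

lemma mirror_inject: "mirror x = mirror y \<longleftrightarrow> x = y"
  by (metis mirror_simps(4))

lemma s_far: "far i j \<Longrightarrow> \<sigma> i * \<sigma> j = \<sigma> j * \<sigma> i"
  using braid_eq.comm[of i j "[]" "[]"] by (simp add: br_Cons flip: br_eq_iff)

lemma s_adj: "adj i j \<Longrightarrow> \<sigma> i * (\<sigma> j * \<sigma> i) = \<sigma> j * (\<sigma> i * \<sigma> j)"
  using braid_eq.braid[of i j "[]" "[]"] by (simp add: br_Cons flip: br_eq_iff)

lemma s_far': "far i j \<Longrightarrow> \<sigma> i * (\<sigma> j * x) = \<sigma> j * (\<sigma> i * x)"
  using arg_cong[OF s_far, of i j "\<lambda>t. t * x"] by (simp add: mult.assoc)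

lemma s_adj': "adj i j \<Longrightarrow> \<sigma> i * (\<sigma> j * (\<sigma> i * x)) = \<sigma> j * (\<sigma> i * (\<sigma> j * x))"
  using arg_cong[OF s_adj, of i j "\<lambda>t. t * x"] by (simp add: mult.assoc)

lemma nonempty_cases: assumes "x \<noteq> 1" obtains i y where "x = \<sigma> i * y"
proof -
  obtain u where u: "x = br u" by (rule br_surj)
  with assms show ?thesis using that by (cases u) (auto simp: br_Cons)
qed

section \<open>Garside's lemma\<close>

text \<open>Right multiplication by \<open>complement i j\<close> turns \<open>\<sigma> i\<close> into the least common right multiple of \<open>\<sigma> i\<close> and
\<open>\<sigma> j\<close>.\<close>

definition complement :: "nat \<Rightarrow> nat \<Rightarrow> posbraid" where
  "complement i j = (if i = j then 1 else if far i j then \<sigma> j else \<sigma> j * \<sigma> i)"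

lemma complement_simps: "complement i i = 1" "far i j \<Longrightarrow> complement i j = \<sigma> j" "adj i j \<Longrightarrow> complement i j = \<sigma> j * \<sigma> i"
  by (auto simp: complement_def far_def adj_def)

lemma s_complement: "\<sigma> i * (complement i j * x) = \<sigma> j * (complement j i * x)"
  by (cases i j rule: index_cases) (auto simp: complement_simps s_far' far_sym adj_sym s_adj' mult.assoc)

text \<open>The conclusion of Garside's lemma for \<open>\<sigma> i * x = \<sigma> j * y\<close>: the equality arises from the least common multiple
of the two generators.\<close>

definition common_split :: "nat \<Rightarrow> nat \<Rightarrow> posbraid \<Rightarrow> posbraid \<Rightarrow> bool" where
  "common_split i j x y \<longleftrightarrow> (\<exists>z. x = complement i j * z \<and> y = complement j i * z)"

lemma common_split_sym: "common_split i j x y \<Longrightarrow> common_split j i y x"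
  by (auto simp: common_split_def)

lemma common_split_same: "common_split i i x y \<longleftrightarrow> x = y"
  by (auto simp: common_split_def complement_simps)

lemma common_split_far: "far i j \<Longrightarrow> common_split i j x y \<longleftrightarrow> (\<exists>z. x = \<sigma> j * z \<and> y = \<sigma> i * z)"
  by (auto simp: common_split_def complement_simps far_sym)

lemma common_split_adj: "adj i j \<Longrightarrow> common_split i j x y \<longleftrightarrow> (\<exists>z. x = \<sigma> j * (\<sigma> i * z) \<and> y = \<sigma> i * (\<sigma> j * z))"
  by (auto simp: common_split_def complement_simps adj_sym mult.assoc)

context
  fixes n :: nat
  assumes IH: "\<And>i j x y. len x < n \<Longrightarrow> \<sigma> i * x = \<sigma> j * y \<Longrightarrow> common_split i j x y"
begin

text \<open>Garside's lemma is proved along a chain of words related by single relations, so the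
conclusion must be transitive in the first letter. The next lemmas verify this for three distinct
first letters \<open>i\<close>, \<open>k\<close>, \<open>j\<close>, according to which of them are adjacent; shorter words may be assumed to satisfy the lemma.\<close>

lemma common_split_via_adj_far:
  assumes ik: "adj i k" and kj: "far k j" and "common_split i k x z" "common_split k j z y" "len z = n"
  shows "common_split i j x y"
proof -
  obtain p where p: "x = \<sigma> k * (\<sigma> i * p)" "z = \<sigma> i * (\<sigma> k * p)"
    using assms common_split_adj by blast
  obtain q where q: "z = \<sigma> j * q" "y = \<sigma> k * q"
    using assms common_split_far by blast
  have "n = Suc (Suc (len p))" using p \<open>len z = n\<close> by auto
  have eq: "\<sigma> i * (\<sigma> k * p) = \<sigma> j * q" using p q by simp
  have "i \<noteq> j" using ik kj by (auto simp: adj_def far_def)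
  then consider "far i j" | "adj i j" by (metis index_cases)
  then show ?thesis
  proof cases
    case 1
    have "common_split i j (\<sigma> k * p) q" using IH[OF _ eq] \<open>n = Suc (Suc (len p))\<close> by simp
    then obtain t where t: "\<sigma> k * p = \<sigma> j * t" "q = \<sigma> i * t" using common_split_far 1 by blast
    then have "common_split k j p t" using IH[OF _ t(1)] \<open>n = Suc (Suc (len p))\<close> by simp
    then obtain u where u: "p = \<sigma> j * u" "t = \<sigma> k * u" using common_split_far kj by blast
    have "x = \<sigma> j * (\<sigma> k * (\<sigma> i * u))"
      unfolding p u by (simp add: s_far'[OF 1] s_far'[OF kj])
    moreover have "y = \<sigma> i * (\<sigma> k * (\<sigma> i * u))"
      unfolding q t u by (simp add: s_adj'[OF adj_sym[OF ik]])
    ultimately show ?thesis using common_split_far[OF 1] by blast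
  next
    case 2
    have "common_split i j (\<sigma> k * p) q" using IH[OF _ eq] \<open>n = Suc (Suc (len p))\<close> by simp
    then obtain t where t: "\<sigma> k * p = \<sigma> j * (\<sigma> i * t)" "q = \<sigma> i * (\<sigma> j * t)" using common_split_adj 2 by blast
    then have "common_split k j p (\<sigma> i * t)" using IH[OF _ t(1)] \<open>n = Suc (Suc (len p))\<close> by simp
    then obtain u where u: "p = \<sigma> j * u" "\<sigma> i * t = \<sigma> k * u" using common_split_far kj by blast
    have "len t = len u" using arg_cong[OF u(2), of len] by simp
    then have "common_split i k t u" using IH[OF _ u(2)] \<open>n = Suc (Suc (len p))\<close> u by simp
    then obtain v where v: "t = \<sigma> k * (\<sigma> i * v)" "u = \<sigma> i * (\<sigma> k * v)" using common_split_adj ik by blast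
    have "x = \<sigma> j * (\<sigma> i * (\<sigma> k * (\<sigma> i * (\<sigma> j * v))))"
    proof -
      have "x = \<sigma> k * (\<sigma> i * (\<sigma> j * (\<sigma> i * (\<sigma> k * v))))" by (simp add: p u v)
      also have "\<dots> = \<sigma> k * (\<sigma> j * (\<sigma> i * (\<sigma> j * (\<sigma> k * v))))" by (simp add: s_adj'[OF 2])
      also have "\<dots> = \<sigma> j * (\<sigma> k * (\<sigma> i * (\<sigma> k * (\<sigma> j * v))))" by (simp add: s_far'[OF kj])
      also have "\<dots> = \<sigma> j * (\<sigma> i * (\<sigma> k * (\<sigma> i * (\<sigma> j * v))))" by (simp add: s_adj'[OF ik])
      finally show ?thesis .
    qed
    moreover have "y = \<sigma> i * (\<sigma> j * (\<sigma> k * (\<sigma> i * (\<sigma> j * v))))"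
    proof -
      have "y = \<sigma> k * (\<sigma> i * (\<sigma> j * (\<sigma> k * (\<sigma> i * v))))" by (simp add: q t v)
      also have "\<dots> = \<sigma> k * (\<sigma> i * (\<sigma> k * (\<sigma> j * (\<sigma> i * v))))" by (simp add: s_far'[OF kj])
      also have "\<dots> = \<sigma> i * (\<sigma> k * (\<sigma> i * (\<sigma> j * (\<sigma> i * v))))" by (simp add: s_adj'[OF ik])
      also have "\<dots> = \<sigma> i * (\<sigma> k * (\<sigma> j * (\<sigma> i * (\<sigma> j * v))))" by (simp add: s_adj'[OF 2])
      also have "\<dots> = \<sigma> i * (\<sigma> j * (\<sigma> k * (\<sigma> i * (\<sigma> j * v))))" by (simp add: s_far'[OF kj])
      finally show ?thesis .
    qed
    ultimately show ?thesis using common_split_adj[OF 2] by blast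
  qed
qed

lemma common_split_via_far_far:
  assumes ik: "far i k" and kj: "far k j" and "common_split i k x z" "common_split k j z y" "len z = n" "i \<noteq> j"
  shows "common_split i j x y"
proof -
  obtain p where p: "x = \<sigma> k * p" "z = \<sigma> i * p"
    using assms common_split_far by blast
  obtain q where q: "z = \<sigma> j * q" "y = \<sigma> k * q"
    using assms common_split_far by blast
  have l: "n = Suc (len p)" using p \<open>len z = n\<close> by auto
  have "\<sigma> i * p = \<sigma> j * q" using p q by simp
  then have sp: "common_split i j p q" using IH l by simp
  consider "far i j" | "adj i j" using \<open>i \<noteq> j\<close> by (metis index_cases)
  then show ?thesis
  proof cases
    case 1
    then obtain r where r: "p = \<sigma> j * r" "q = \<sigma> i * r" using sp common_split_far by blast
    have "x = \<sigma> j * (\<sigma> k * r)" "y = \<sigma> i * (\<sigma> k * r)"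
      by (simp_all add: p q r s_far'[OF kj] s_far'[OF far_sym[OF ik]])
    then show ?thesis using common_split_far[OF 1] by blast
  next
    case 2
    then obtain r where r: "p = \<sigma> j * (\<sigma> i * r)" "q = \<sigma> i * (\<sigma> j * r)" using sp common_split_adj by blast
    have "x = \<sigma> j * (\<sigma> i * (\<sigma> k * r))" "y = \<sigma> i * (\<sigma> j * (\<sigma> k * r))"
      by (simp_all add: p q r s_far'[OF kj] s_far'[OF far_sym[OF ik]])
    then show ?thesis using common_split_adj[OF 2] by blast
  qed
qed

lemma common_split_via_adj_adj:
  assumes ik: "adj i k" and kj: "adj k j" and "common_split i k x z" "common_split k j z y" "len z = n" "i \<noteq> j"
  shows "common_split i j x y"
proof -
  have ij: "far i j" using ik kj \<open>i \<noteq> j\<close> by (auto simp: adj_def far_def)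
  obtain p where p: "x = \<sigma> k * (\<sigma> i * p)" "z = \<sigma> i * (\<sigma> k * p)"
    using assms common_split_adj by blast
  obtain q where q: "z = \<sigma> j * (\<sigma> k * q)" "y = \<sigma> k * (\<sigma> j * q)"
    using assms common_split_adj by blast
  have "len (\<sigma> i * (\<sigma> k * p)) = n" "len (\<sigma> j * (\<sigma> k * q)) = n"
    using p(2) q(1) \<open>len z = n\<close> by metis+
  then have l: "n = Suc (Suc (len p))" "n = Suc (Suc (len q))" by auto
  have "\<sigma> i * (\<sigma> k * p) = \<sigma> j * (\<sigma> k * q)" using p q by simp
  then have "common_split i j (\<sigma> k * p) (\<sigma> k * q)" using IH l by simp
  then obtain r where r: "\<sigma> k * p = \<sigma> j * r" "\<sigma> k * q = \<sigma> i * r" using common_split_far ij by blast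
  obtain t where t: "p = \<sigma> j * (\<sigma> k * t)" "r = \<sigma> k * (\<sigma> j * t)"
    using IH[OF _ r(1)] l common_split_adj[OF kj] by auto
  obtain u where u: "q = \<sigma> i * (\<sigma> k * u)" "r = \<sigma> k * (\<sigma> i * u)"
    using IH[OF _ r(2)] l common_split_adj[OF adj_sym[OF ik]] by auto
  have "\<sigma> k * (\<sigma> j * t) = \<sigma> k * (\<sigma> i * u)" using t u by simp
  then have eq: "\<sigma> j * t = \<sigma> i * u"
    using IH[of "\<sigma> j * t" k k "\<sigma> i * u"] l t common_split_same by simp
  obtain v where v: "t = \<sigma> i * v" "u = \<sigma> j * v"
    using IH[OF _ eq] l t common_split_far[OF far_sym[OF ij]] by auto
  have "x = \<sigma> j * (\<sigma> k * (\<sigma> j * (\<sigma> i * (\<sigma> k * v))))"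
  proof -
    have "x = \<sigma> k * (\<sigma> i * (\<sigma> j * (\<sigma> k * (\<sigma> i * v))))" by (simp add: p t v)
    also have "\<dots> = \<sigma> k * (\<sigma> j * (\<sigma> i * (\<sigma> k * (\<sigma> i * v))))" by (simp add: s_far'[OF ij])
    also have "\<dots> = \<sigma> k * (\<sigma> j * (\<sigma> k * (\<sigma> i * (\<sigma> k * v))))" by (simp add: s_adj'[OF ik])
    also have "\<dots> = \<sigma> j * (\<sigma> k * (\<sigma> j * (\<sigma> i * (\<sigma> k * v))))" by (simp add: s_adj'[OF kj])
    finally show ?thesis .
  qed
  moreover have "y = \<sigma> i * (\<sigma> k * (\<sigma> j * (\<sigma> i * (\<sigma> k * v))))"
  proof -
    have "y = \<sigma> k * (\<sigma> j * (\<sigma> i * (\<sigma> k * (\<sigma> j * v))))" by (simp add: q u v)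
    also have "\<dots> = \<sigma> k * (\<sigma> i * (\<sigma> j * (\<sigma> k * (\<sigma> j * v))))" by (simp add: s_far'[OF ij])
    also have "\<dots> = \<sigma> k * (\<sigma> i * (\<sigma> k * (\<sigma> j * (\<sigma> k * v))))" by (simp add: s_adj'[OF adj_sym[OF kj]])
    also have "\<dots> = \<sigma> i * (\<sigma> k * (\<sigma> i * (\<sigma> j * (\<sigma> k * v))))" by (simp add: s_adj'[OF adj_sym[OF ik]])
    also have "\<dots> = \<sigma> i * (\<sigma> k * (\<sigma> j * (\<sigma> i * (\<sigma> k * v))))" by (simp add: s_far'[OF ij])
    finally show ?thesis .
  qed
  ultimately show ?thesis using common_split_far[OF ij] by blast
qed

text \<open>For \<open>i = j \<noteq> k\<close> the claim is left cancellation of \<open>complement k i\<close>, which is available for shorter words.\<close>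

lemma common_split_trans:
  assumes "common_split i k x z" "common_split k j z y" "len z = n"
  shows "common_split i j x y"
proof -
  consider "i = k" | "k = j" | "i = j" "i \<noteq> k" | "i \<noteq> k" "k \<noteq> j" "i \<noteq> j" by blast
  then show ?thesis
  proof cases
    case 3
    obtain p where p: "x = complement i k * p" "z = complement k i * p" using assms common_split_def by blast
    obtain q where q: "z = complement k i * q" "y = complement i k * q" using assms 3 common_split_def by blast
    have "complement k i * p = complement k i * q" using p q by simp
    have "p = q"
    proof (cases "far k i")
      case True
      then show ?thesis using p q IH[of p i i q] \<open>len z = n\<close> common_split_same by (simp add: complement_simps)
    next
      case False
      then have "adj k i" using 3 by (metis index_cases)
      then show ?thesis using p q IH[of "\<sigma> k * p" i i "\<sigma> k * q"] IH[of p k k q] \<open>len z = n\<close> common_split_same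
        by (simp add: complement_simps mult.assoc)
    qed
    then show ?thesis using p q 3 common_split_same by simp
  next
    case 4
    have l: "len z = n" by fact
    from 4 consider "far i k" "far k j" | "adj i k" "far k j" | "far i k" "adj k j" | "adj i k" "adj k j"
      by (metis index_cases)
    then show ?thesis
    proof cases
      case 1 then show ?thesis using common_split_via_far_far assms 4 by blast
    next
      case 2 then show ?thesis using common_split_via_adj_far assms by blast
    next
      case 3
      then show ?thesis
        using common_split_via_adj_far[OF adj_sym far_sym common_split_sym common_split_sym l] assms common_split_sym by blast
    next
      case c: 4 then show ?thesis using common_split_via_adj_adj assms 4 by blast
    qed
  qed (use assms common_split_same in auto)
qed

end

text \<open>Induction on the length, and for fixed length on the derivation of the equality of the two words. In a transitive
step the intermediate word has a first letter \<open>k\<close> of its own, and the two halves are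
joined by \<open>common_split_trans\<close>.\<close>

theorem garside_key: "\<sigma> i * x = \<sigma> j * y \<Longrightarrow> common_split i j x y"
proof (induction "len x" arbitrary: i j x y rule: less_induct)
  case less
  have IH: "\<And>i j x' y. len x' < len x \<Longrightarrow> \<sigma> i * x' = \<sigma> j * y \<Longrightarrow> common_split i j x' y"
    using less.hyps by blast
  have main: "common_split i j (br u') (br v')"
    if "braid_eq u v" "length u = Suc (len x)" "u = i # u'" "v = j # v'" for u v i j u' v'
    using that
  proof (induction arbitrary: i j u' v' rule: braid_eq.induct)
    case (comm a b l r)
    show ?case
    proof (cases l)
      case Nil
      then show ?thesis using comm by (auto simp: common_split_far br_Cons)
    next
      case (Cons h l')
      then show ?thesis using comm braid_eq.comm[of a b l' r] by (auto simp: common_split_same br_eq_iff)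
    qed
  next
    case (braid a b l r)
    show ?case
    proof (cases l)
      case Nil
      then show ?thesis using braid by (auto simp: common_split_adj br_Cons)
    next
      case (Cons h l')
      then show ?thesis using braid braid_eq.braid[of a b l' r] by (auto simp: common_split_same br_eq_iff)
    qed
  next
    case (refl u)
    then show ?case by (simp add: common_split_same)
  next
    case (sym u v)
    then show ?case using braid_eq_length common_split_sym by metis
  next
    case (trans u v w)
    have "length v = Suc (len x)" using trans braid_eq_length by metis
    then obtain k v0 where v: "v = k # v0" by (cases v) auto
    have "common_split i k (br u') (br v0)" "common_split k j (br v0) (br v')"
      using trans v \<open>length v = _\<close> by blast+
    then show ?case using common_split_trans[OF IH] v \<open>length v = _\<close> by fastforce
  qed
  obtain u v where "x = br u" "y = br v" by (metis br_surj)
  then show ?case using main[of "i # u" "j # v"] less.prems by (simp add: br_eq_iff flip: br_Cons)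
qed

lemma s_cancel: "\<sigma> i * x = \<sigma> i * y \<Longrightarrow> x = y"
  using garside_key common_split_same by blast

lemma left_cancel: "a * x = a * y \<Longrightarrow> x = y" for a :: posbraid
proof -
  obtain u where "a = br u" by (rule br_surj)
  moreover have "br u * x = br u * y \<Longrightarrow> x = y"
    by (induction u) (auto simp: br_Cons mult.assoc dest: s_cancel)
  ultimately show "a * x = a * y \<Longrightarrow> x = y" by simp
qed

lemma right_cancel: "x * a = y * a \<Longrightarrow> x = y" for a :: posbraid
  by (metis left_cancel mirror_inject mirror_simps(3))

lemma left_cancel_iff [simp]: "a * x = a * y \<longleftrightarrow> x = y" for a x y :: posbraid
  using left_cancel by blast

lemma right_cancel_iff [simp]: "x * a = y * a \<longleftrightarrow> x = y" for a x y :: posbraid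
  using right_cancel by blast

section \<open>Least common multiples and square roots\<close>

definition ldvd :: "posbraid \<Rightarrow> posbraid \<Rightarrow> bool" (infix "ldvd" 50) where
  "a ldvd b \<longleftrightarrow> (\<exists>c. b = a * c)"

definition is_lcm :: "posbraid \<Rightarrow> posbraid \<Rightarrow> posbraid \<Rightarrow> bool" where
  "is_lcm a b l \<longleftrightarrow> (\<forall>t. l ldvd t \<longleftrightarrow> a ldvd t \<and> b ldvd t)"

lemma ldvd_refl [simp]: "a ldvd a"
  unfolding ldvd_def by (metis mult_1_right)

lemma one_ldvd [simp]: "1 ldvd a"
  unfolding ldvd_def by simp

lemma ldvd_mult [simp]: "c * a ldvd c * b \<longleftrightarrow> a ldvd b"
  unfolding ldvd_def mult.assoc by simp

lemma ldvd_trans: "a ldvd b \<Longrightarrow> b ldvd c \<Longrightarrow> a ldvd c"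
  unfolding ldvd_def by (metis mult.assoc)

lemma mult_ldvd: "a * b ldvd c \<longleftrightarrow> (\<exists>d. c = a * d \<and> b ldvd d)"
  unfolding ldvd_def mult.assoc by blast

text \<open>Induction on the length of the common multiple \<open>w\<close>. Let \<open>\<sigma> i\<close> and \<open>\<sigma> j\<close> be the first letters of \<open>a\<close> and \<open>b\<close>. By
Garside's lemma every common multiple is \<open>\<sigma> i * (complement i j * z)\<close> for some \<open>z\<close>; the conditions that \<open>a\<close> and
\<open>b\<close> impose on \<open>z\<close> are that it be a multiple of certain \<open>f\<close> and \<open>f'\<close>, found by taking least common multiples of shorter elements, and the
least such \<open>z\<close> is their least common multiple.\<close>

lemma ex_lcm:
  assumes "a ldvd w" "b ldvd w"
  shows "\<exists>l. is_lcm a b l"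
  using assms
proof (induction "len w" arbitrary: w a b rule: less_induct)
  case less
  show ?case
  proof (cases "a = 1 \<or> b = 1")
    case True
    then show ?thesis by (auto simp: is_lcm_def)
  next
    case False
    then obtain i a' j b' where ab: "a = \<sigma> i * a'" "b = \<sigma> j * b'" by (metis nonempty_cases)
    \<comment> \<open>the common multiples of \<open>a\<close> and \<open>b\<close> in terms of \<open>z\<close>\<close>
    have key: "\<exists>z. t = \<sigma> i * (complement i j * z) \<and> a' ldvd complement i j * z \<and> b' ldvd complement j i * z"
      if ab_t: "a ldvd t" "b ldvd t" for t
    proof -
      obtain t1 t2 where t: "t = \<sigma> i * t1" "a' ldvd t1" "t = \<sigma> j * t2" "b' ldvd t2"
        using ab_t unfolding ab mult_ldvd by blast
      then have "common_split i j t1 t2" using garside_key by simp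
      then show ?thesis using t by (auto simp: common_split_def)
    qed
    obtain z where w: "w = \<sigma> i * (complement i j * z)" and z: "a' ldvd complement i j * z" "b' ldvd complement j i * z"
      using key less.prems by blast
    have w': "w = \<sigma> j * (complement j i * z)" unfolding w by (rule s_complement)
    obtain e where e: "is_lcm a' (complement i j) e"
      using less.hyps[of "complement i j * z" a' "complement i j"] w z(1) unfolding ldvd_def by auto
    have "complement i j ldvd e" using e ldvd_refl[of e] unfolding is_lcm_def by blast
    then obtain f where f: "e = complement i j * f" unfolding ldvd_def by blast
    obtain e' where e': "is_lcm b' (complement j i) e'"
      using less.hyps[of "complement j i * z" b' "complement j i"] w' z(2) unfolding ldvd_def by auto
    have "complement j i ldvd e'" using e' ldvd_refl[of e'] unfolding is_lcm_def by blast
    then obtain f' where f': "e' = complement j i * f'" unfolding ldvd_def by blast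
    have complement_ldvd: "complement i j ldvd complement i j * t" "complement j i ldvd complement j i * t" for t
      unfolding ldvd_def by blast+
    have A: "a' ldvd complement i j * t \<longleftrightarrow> f ldvd t" for t
      using e[unfolded is_lcm_def f, rule_format, of "complement i j * t"] complement_ldvd by simp
    have B: "b' ldvd complement j i * t \<longleftrightarrow> f' ldvd t" for t
      using e'[unfolded is_lcm_def f', rule_format, of "complement j i * t"] complement_ldvd by simp
    obtain g where g: "is_lcm f f' g"
      using less.hyps[of z f f'] w z A B by auto
    have "is_lcm a b (\<sigma> i * (complement i j * g))"
      unfolding is_lcm_def
    proof (intro allI iffI conjI)
      fix t assume t: "\<sigma> i * (complement i j * g) ldvd t"
      have "f ldvd g" "f' ldvd g" using g is_lcm_def by auto
      then have "a' ldvd complement i j * g" "b' ldvd complement j i * g" using A B by auto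
      then have "a ldvd \<sigma> i * (complement i j * g)" "b ldvd \<sigma> j * (complement j i * g)"
        unfolding ab by simp_all
      then have "a ldvd \<sigma> i * (complement i j * g)" "b ldvd \<sigma> i * (complement i j * g)"
        unfolding s_complement[of j] by simp_all
      then show "a ldvd t" "b ldvd t" using t ldvd_trans by blast+
    next
      fix t assume "a ldvd t \<and> b ldvd t"
      then obtain y where "t = \<sigma> i * (complement i j * y)" "f ldvd y" "f' ldvd y"
        using key A B by blast
      then show "\<sigma> i * (complement i j * g) ldvd t" using g is_lcm_def by simp
    qed
    then show ?thesis by blast
  qed
qed

text \<open>The length is additive and vanishes only at \<open>1\<close>, so there are no units to divide by.\<close>

lemma ldvd_antisym: "a ldvd b \<Longrightarrow> b ldvd a \<Longrightarrow> a = b"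
proof -
  assume "a ldvd b" "b ldvd a"
  then obtain c d where c: "b = a * c" "a = b * d" by (auto simp: ldvd_def)
  have "len b = len a + len c" "len a = len b + len d"
    using arg_cong[OF c(1), of len] arg_cong[OF c(2), of len] by simp_all
  then have "len c = 0" by simp
  then have "c = 1" by (metis nonempty_cases len_simps(2,4) add_is_0 one_neq_zero)
  then show "a = b" using c(1) by simp
qed

text \<open>If \<open>l\<close> is the least common multiple of \<open>y\<close> and \<open>z\<close>, then the multiples of \<open>y * l\<close> are the common multiples of
\<open>y * y\<close> and \<open>y * z\<close>, and those of \<open>z * l\<close> the common multiples of \<open>z * y\<close> and \<open>z * z\<close>. These
agree, so \<open>y * l = z * l\<close>, and \<open>l\<close> cancels.\<close>

theorem square_root_unique:
  fixes y z :: posbraid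
  assumes sq: "y * y = z * z" and comm: "y * z = z * y"
  shows "y = z"
proof -
  have "y ldvd y * z" "z ldvd y * z" unfolding ldvd_def by (blast, metis comm)
  then obtain l where l: "is_lcm y z l" using ex_lcm by blast
  have "y * l ldvd t \<longleftrightarrow> z * l ldvd t" for t
  proof -
    have L: "c * l ldvd t \<longleftrightarrow> c * y ldvd t \<and> c * z ldvd t" for c
      using l unfolding mult_ldvd is_lcm_def by (metis left_cancel)
    show ?thesis unfolding L using sq comm by metis
  qed
  then have "y * l = z * l" by (meson ldvd_antisym ldvd_refl)
  then show ?thesis by simp
qed

section \<open>Ascending and descending words\<close>

abbreviation up :: "nat \<Rightarrow> nat \<Rightarrow> posbraid" where "up a b \<equiv> br [a..<b]"
abbreviation down :: "nat \<Rightarrow> nat \<Rightarrow> posbraid" where "down a b \<equiv> br (rev [a..<b])"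

lemma br_commute_s: "(\<And>j. j \<in> set u \<Longrightarrow> \<sigma> j * x = x * \<sigma> j) \<Longrightarrow> br u * x = x * br u"
proof (induction u)
  case (Cons j u)
  have "br (j # u) * x = \<sigma> j * (br u * x)" by (simp add: br_Cons mult.assoc)
  also have "\<dots> = \<sigma> j * x * br u" using Cons by (simp flip: mult.assoc)
  also have "\<dots> = x * br (j # u)" using Cons.prems[of j] by (simp add: br_Cons flip: mult.assoc)
  finally show ?case .
qed simp

lemma s_br_far:
  assumes "\<And>j. j \<in> set u \<Longrightarrow> far i j"
  shows "\<sigma> i * br u = br u * \<sigma> i"
  using br_commute_s[of u "\<sigma> i"] assms s_far by metis

lemma br_br_far: "(\<And>i j. i \<in> set u \<Longrightarrow> j \<in> set v \<Longrightarrow> far i j) \<Longrightarrow> br u * br v = br v * br u"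
  using br_commute_s[of u "br v"] s_br_far by metis

text \<open>Conjugation by \<open>\<sigma>\<^sub>a \<dots> \<sigma>\<^bsub>b-1\<^esub>\<close> raises the index of a generator by one, since this braid rotates the strings cyclically.\<close>

lemma up_shift:
  assumes "a \<le> i" "Suc i < b"
  shows "up a b * \<sigma> i = \<sigma> (Suc i) * up a b"
proof -
  have "[a..<b] = [a..<i] @ [i..<b]" using assms upt_add_eq_append[of a i "b - i"] by simp
  moreover have "[i..<b] = i # Suc i # [Suc (Suc i)..<b]" using assms by (simp add: upt_conv_Cons)
  ultimately have u: "up a b = up a i * (\<sigma> i * (\<sigma> (Suc i) * up (Suc (Suc i)) b))"
    by (simp add: br_append br_Cons)
  have "up (Suc (Suc i)) b * \<sigma> i = \<sigma> i * up (Suc (Suc i)) b"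
    by (rule s_br_far[symmetric]) (auto simp: far_def)
  then have "up a b * \<sigma> i = up a i * (\<sigma> i * (\<sigma> (Suc i) * (\<sigma> i * up (Suc (Suc i)) b)))"
    by (simp add: u mult.assoc)
  also have "\<dots> = (up a i * \<sigma> (Suc i)) * (\<sigma> i * (\<sigma> (Suc i) * up (Suc (Suc i)) b))"
    using s_adj'[of i "Suc i"] by (simp add: mult.assoc adj_def)
  also have "up a i * \<sigma> (Suc i) = \<sigma> (Suc i) * up a i"
    by (rule s_br_far[symmetric]) (auto simp: far_def)
  finally show ?thesis by (simp add: u mult.assoc)
qed

lemma down_shift:
  assumes "a \<le> i" "Suc i < b"
  shows "down a b * \<sigma> (Suc i) = \<sigma> i * down a b"
  using arg_cong[OF up_shift[OF assms], of mirror] by simp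

lemma up_shift_br:
  assumes "\<And>i. i \<in> set u \<Longrightarrow> a \<le> i \<and> Suc i < b"
  shows "up a b * br u = br (map Suc u) * up a b"
  using assms
proof (induction u)
  case (Cons i u)
  have "up a b * br (i # u) = (up a b * \<sigma> i) * br u" by (simp add: br_Cons mult.assoc)
  also have "\<dots> = \<sigma> (Suc i) * (up a b * br u)" using Cons.prems by (simp add: up_shift mult.assoc)
  also have "\<dots> = br (map Suc (i # u)) * up a b" using Cons by (simp add: br_Cons mult.assoc)
  finally show ?case .
qed simp

lemma up_down_commute:
  assumes "a < j" "j < b"
  shows "\<sigma> j * (up a b * down a b) = up a b * down a b * \<sigma> j"
proof -
  obtain i where i: "j = Suc i" "a \<le> i" "Suc i < b" using assms by (cases j) auto
  have "up a b * down a b * \<sigma> j = up a b * \<sigma> i * down a b"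
    using i down_shift by (simp add: mult.assoc)
  then show ?thesis using i up_shift by (simp add: mult.assoc)
qed

lemma down_up_commute:
  assumes "a \<le> j" "Suc j < b"
  shows "\<sigma> j * (down a b * up a b) = down a b * up a b * \<sigma> j"
proof -
  have "down a b * up a b * \<sigma> j = down a b * \<sigma> (Suc j) * up a b"
    using assms up_shift by (simp add: mult.assoc)
  then show ?thesis using assms down_shift by (simp add: mult.assoc)
qed

section \<open>The half twist\<close>

fun half_twist :: "nat \<Rightarrow> nat list" where
  "half_twist 0 = []"
| "half_twist (Suc m) = [1..<Suc m] @ half_twist m"

abbreviation "\<Delta> m \<equiv> br (half_twist m)"

lemma set_half_twist: "set (half_twist m) \<subseteq> {1..<m}"
  by (induction m) auto

lemma half_twist_down: "up 1 (Suc m) * \<Delta> m = \<Delta> m * down 1 (Suc m)"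
proof (induction m)
  case (Suc m)
  show ?case
  proof (cases "m = 0")
    case False
    have "\<sigma> (Suc m) * \<Delta> m = \<Delta> m * \<sigma> (Suc m)"
      using set_half_twist[of m] by (intro s_br_far) (force simp: far_def)
    then have D: "\<Delta> (Suc m) * \<sigma> (Suc m) = up 1 (Suc m) * (\<sigma> (Suc m) * \<Delta> m)"
      by (simp add: br_append mult.assoc del: upt_Suc)
    have U: "up 1 (Suc (Suc m)) = up 1 (Suc m) * \<sigma> (Suc m)"
      "down 1 (Suc (Suc m)) = \<sigma> (Suc m) * down 1 (Suc m)"
      using upt_Suc[of 1 "Suc m"] by (simp_all add: br_append br_Cons del: upt_Suc)
    have "up 1 (Suc (Suc m)) * \<Delta> (Suc m) = up 1 (Suc m) * (\<sigma> (Suc m) * (up 1 (Suc m) * \<Delta> m))"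
      unfolding U half_twist.simps br_append by (simp only: mult.assoc)
    moreover have "\<Delta> (Suc m) * down 1 (Suc (Suc m)) = up 1 (Suc m) * (\<sigma> (Suc m) * (\<Delta> m * down 1 (Suc m)))"
      unfolding U mult.assoc[symmetric] D by (simp only: mult.assoc)
    ultimately show ?thesis using Suc by simp
  qed simp
qed simp

lemma mirror_half_twist: "mirror (\<Delta> m) = \<Delta> m"
proof (induction m)
  case (Suc m)
  have "mirror (\<Delta> (Suc m)) = mirror (\<Delta> m) * down 1 (Suc m)"
    unfolding half_twist.simps br_append mirror_simps(3) by simp
  then show ?case using Suc half_twist_down[of m] by (simp add: br_append)
qed simp

text \<open>For \<open>i\<close> below the last generator the flip follows by induction and \<open>up_shift\<close>; for the last generator it is the
mirror image of the case \<open>i = 1\<close>, as the half twist is a palindrome up to braid relations.\<close>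

lemma half_twist_flip:
  assumes "1 \<le> i" "i < m"
  shows "\<Delta> m * \<sigma> i = \<sigma> (m - i) * \<Delta> m"
  using assms
proof (induction m arbitrary: i)
  case (Suc m)
  \<comment> \<open>all generators but the last one\<close>
  have low: "\<Delta> (Suc m) * \<sigma> i = \<sigma> (Suc m - i) * \<Delta> (Suc m)" if "1 \<le> i" "i < m" for i
  proof -
    have "\<Delta> (Suc m) * \<sigma> i = up 1 (Suc m) * \<sigma> (m - i) * \<Delta> m"
      using Suc.IH[OF that] by (simp add: br_append mult.assoc del: upt_Suc)
    also have "\<dots> = \<sigma> (Suc (m - i)) * (up 1 (Suc m) * \<Delta> m)"
      using that by (subst up_shift) (auto simp: mult.assoc)
    finally show ?thesis using that by (simp add: br_append Suc_diff_le del: upt_Suc)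
  qed
  consider "i < m" | "i = m" "m = 1" | "i = m" "1 < m" using Suc.prems by linarith
  then show ?case
  proof cases
    case 1 then show ?thesis using low Suc.prems by blast
  next
    case 2 then show ?thesis by (simp add: br_Cons)
  next
    case 3
    have "\<Delta> (Suc m) * \<sigma> 1 = \<sigma> m * \<Delta> (Suc m)" using low[of 1] 3 by simp
    from arg_cong[OF this, of mirror] have "\<sigma> 1 * \<Delta> (Suc m) = \<Delta> (Suc m) * \<sigma> m"
      unfolding mirror_simps(2,3) mirror_half_twist .
    then show ?thesis using 3 by simp
  qed
qed simp

text \<open>A full twist of \<open>m + 1\<close> strings is a full twist of the first \<open>m\<close>, followed by the last string running once around them.\<close>

lemma half_twist_square_Suc:
  "\<Delta> (Suc m) * \<Delta> (Suc m) = \<Delta> m * \<Delta> m * (down 1 (Suc m) * up 1 (Suc m))"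
proof -
  have comm: "\<Delta> m * (down 1 (Suc m) * up 1 (Suc m)) = down 1 (Suc m) * up 1 (Suc m) * \<Delta> m"
    using set_half_twist[of m]
    by (intro br_commute_s) (use down_up_commute[of 1 _ "Suc m"] in \<open>auto simp del: upt_Suc simp: subset_iff\<close>)
  have D: "\<Delta> (Suc m) = up 1 (Suc m) * \<Delta> m" "\<Delta> (Suc m) = \<Delta> m * down 1 (Suc m)"
    unfolding half_twist.simps br_append half_twist_down by simp_all
  have "\<Delta> (Suc m) * \<Delta> (Suc m) = \<Delta> m * down 1 (Suc m) * (up 1 (Suc m) * \<Delta> m)"
    by (subst D(2), subst D(1)) simp
  then have "\<Delta> (Suc m) * \<Delta> (Suc m) = \<Delta> m * (down 1 (Suc m) * up 1 (Suc m) * \<Delta> m)"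
    by (simp only: mult.assoc)
  then show ?thesis unfolding comm[symmetric] by (simp only: mult.assoc)
qed

text \<open>Both sides are the full twist: \<open>m\<close> rotations by one place turn the whole braid once.\<close>

lemma half_twist_square: "\<Delta> m * \<Delta> m = up 1 m ^ m"
proof (induction m)
  case (Suc m)
  \<comment> \<open>\<open>j\<close> rotations of \<open>m + 1\<close> strings are \<open>j\<close> rotations of the first \<open>m\<close> followed by the last string passing \<open>j\<close> of them; the case \<open>j = m\<close> is used\<close>
  have pow: "up 1 m ^ j * down (Suc m - j) (Suc m) = up 1 (Suc m) ^ j" if "j \<le> m" for j
    using that
  proof (induction j)
    case (Suc j)
    let ?u = "rev [m - j..<m]"
    have m: "m = Suc (m - 1)" using Suc.prems by simp
    have "map Suc [m - j..<m] = [Suc m - j..<Suc m]"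
      using Suc.prems by (simp add: map_Suc_upt Suc_diff_le)
    then have "map Suc ?u = rev [Suc m - j..<Suc m]" by (simp only: flip: rev_map)
    moreover have "up 1 (Suc m) * br ?u = br (map Suc ?u) * up 1 (Suc m)"
      by (rule up_shift_br) (use Suc.prems in auto)
    ultimately have sh: "up 1 (Suc m) * br ?u = down (Suc m - j) (Suc m) * up 1 (Suc m)"
      by simp
    have dn: "down (Suc m - Suc j) (Suc m) = \<sigma> m * br ?u" using Suc.prems by (simp add: br_Cons)
    have "up 1 m * \<sigma> m = up 1 (Suc m)" using Suc.prems by (simp add: br_append br_Cons)
    then have "up 1 m ^ Suc j * down (Suc m - Suc j) (Suc m) = up 1 m ^ j * (up 1 (Suc m) * br ?u)"
      unfolding dn power_Suc2 by (metis mult.assoc)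
    also have "\<dots> = up 1 m ^ j * down (Suc m - j) (Suc m) * up 1 (Suc m)"
      unfolding sh by (simp only: mult.assoc)
    also have "\<dots> = up 1 (Suc m) ^ Suc j"
      using Suc unfolding power_Suc2 by simp
    finally show ?case .
  qed simp
  show ?case
    using Suc half_twist_square_Suc[of m] pow[of m]
    by (simp add: power_Suc2 flip: mult.assoc del: power_Suc half_twist.simps upt_Suc)
qed simp

section \<open>One string running around all the others\<close>

text \<open>The pure braid in which the \<open>k\<close>th of \<open>m\<close> strings runs once around all the others. For \<open>k = 1\<close>, with \<open>m\<close>
the number of strings, it is the left-hand side of the sphere relation; for other \<open>k\<close> it is a cyclic rotation of that word.\<close>

definition circuit :: "nat \<Rightarrow> nat \<Rightarrow> nat list" where
  "circuit m k = [k..<m] @ rev [1..<m] @ [1..<k]"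

lemma br_circuit:
  assumes "1 \<le> k" "k \<le> m"
  shows "br (circuit m k) = up k m * down k m * (down 1 k * up 1 k)"
proof -
  have "[1..<m] = [1..<k] @ [k..<m]" using assms upt_add_eq_append[of 1 k "m - k"] by simp
  then show ?thesis by (simp add: circuit_def br_append mult.assoc)
qed

lemma set_circuit: "1 \<le> k \<Longrightarrow> k \<le> m \<Longrightarrow> set (circuit m k) \<subseteq> {1..<m}"
  by (auto simp: circuit_def)

lemma circuit_commute:
  assumes "1 \<le> k" "k \<le> m" "1 \<le> j" "j < m" "j \<noteq> k" "Suc j \<noteq> k"
  shows "\<sigma> j * br (circuit m k) = br (circuit m k) * \<sigma> j"
proof (cases "k < j")
  case True
  have "\<sigma> j * (down 1 k * up 1 k) = down 1 k * up 1 k * \<sigma> j"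
    using True by (subst (1 2) br_append[symmetric], intro s_br_far) (auto simp: far_def)
  moreover have "\<sigma> j * (up k m * down k m) = up k m * down k m * \<sigma> j"
    using True assms by (intro up_down_commute) auto
  ultimately show ?thesis unfolding br_circuit[OF assms(1,2)] by (metis mult.assoc)
next
  case False
  have "\<sigma> j * (up k m * down k m) = up k m * down k m * \<sigma> j"
    using False assms by (subst (1 2) br_append[symmetric], intro s_br_far) (auto simp: far_def)
  moreover have "\<sigma> j * (down 1 k * up 1 k) = down 1 k * up 1 k * \<sigma> j"
    using False assms by (intro down_up_commute) auto
  ultimately show ?thesis unfolding br_circuit[OF assms(1,2)] by (metis mult.assoc)
qed

lemma circuit_Suc:
  assumes "1 \<le> k" "k < m"
  shows "\<sigma> k * br (circuit m (Suc k)) = br (circuit m k) * \<sigma> k"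
  using assms by (simp add: circuit_def br_append br_Cons mult.assoc upt_conv_Cons)

text \<open>The \<open>i\<close>th and \<open>(i+1)\<close>st strings running one after the other around everything else is not affected by
their being twisted around each other. For \<open>i = 1\<close> this reduces to the fact that the circuit of the first string commutes with braids of
the others; conjugation by \<open>\<sigma>\<^bsub>i+1\<^esub> \<sigma>\<^sub>i\<close> takes the statement for \<open>i\<close> to the one for \<open>i + 1\<close>.\<close>

lemma circuit_pair_commute:
  assumes "1 \<le> i" "i < m"
  shows "\<sigma> i * (br (circuit m i) * br (circuit m (Suc i))) = br (circuit m i) * br (circuit m (Suc i)) * \<sigma> i"
  using assms
proof (induction i rule: nat_induct_at_least)
  case base
  let ?e = "br (circuit m 1)" and ?b = "up 2 m * down 2 m"
  have up1: "[1..<m] = 1 # [2..<m]" using base by (simp add: upt_conv_Cons numeral_2_eq_2)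
  \<comment> \<open>both circuits in terms of \<open>?b\<close>, the second string running around the later ones\<close>
  have e1: "?e = \<sigma> 1 * (?b * \<sigma> 1)"
    unfolding circuit_def up1 by (simp add: br_append br_Cons mult.assoc)
  have e2: "br (circuit m (Suc 1)) = ?b * (\<sigma> 1 * \<sigma> 1)"
    unfolding circuit_def up1 by (simp add: br_append br_Cons mult.assoc numeral_2_eq_2)
  have "br ([2..<m] @ rev [2..<m]) * ?e = ?e * br ([2..<m] @ rev [2..<m])"
    by (rule br_commute_s) (use base in \<open>auto intro!: circuit_commute\<close>)
  then have "?b * ?e = ?e * ?b" by (simp only: br_append)
  then have c: "?b * (\<sigma> 1 * (?b * \<sigma> 1)) = \<sigma> 1 * (?b * (\<sigma> 1 * ?b))"
    unfolding e1 by (simp add: mult.assoc)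
  have c': "?b * (\<sigma> 1 * (?b * (\<sigma> 1 * x))) = \<sigma> 1 * (?b * (\<sigma> 1 * (?b * x)))" for x
    using arg_cong[OF c, of "\<lambda>t. t * x"] by (simp only: mult.assoc)
  show ?case
    unfolding e1 e2 One_nat_def[symmetric] using c'[of "\<sigma> 1"] c'[of "\<sigma> 1 * \<sigma> 1"]
    by (simp only: mult.assoc)
next
  case (Suc i)
  let ?e = "\<lambda>i. br (circuit m i)" and ?v = "\<sigma> (Suc i) * \<sigma> i"
  have i: "1 \<le> i" "Suc i < m" using Suc by simp_all
  have v: "\<sigma> i * ?v = ?v * \<sigma> (Suc i)"
    using s_adj[of i "Suc i"] by (simp add: adj_def mult.assoc)
  have "?e i * ?v = \<sigma> (Suc i) * (?e i * \<sigma> i)"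
    using circuit_commute[of i m "Suc i"] i by (simp flip: mult.assoc)
  also have "\<dots> = ?v * ?e (Suc i)" using circuit_Suc[of i m] i by (simp add: mult.assoc)
  finally have e1: "?e i * ?v = ?v * ?e (Suc i)" .
  have "?e (Suc i) * ?v = \<sigma> (Suc i) * (?e (Suc (Suc i)) * \<sigma> i)"
    using circuit_Suc[of "Suc i" m] i by (simp flip: mult.assoc)
  also have "\<dots> = ?v * ?e (Suc (Suc i))"
    using circuit_commute[of "Suc (Suc i)" m i] i by (simp add: mult.assoc)
  finally have e2: "?e (Suc i) * ?v = ?v * ?e (Suc (Suc i))" .
  have ee: "?e i * ?e (Suc i) * ?v = ?v * (?e (Suc i) * ?e (Suc (Suc i)))"
    using e1 e2 by (metis mult.assoc)
  have "?v * (\<sigma> (Suc i) * (?e (Suc i) * ?e (Suc (Suc i)))) = \<sigma> i * (?e i * ?e (Suc i) * ?v)"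
    unfolding ee using v by (simp only: mult.assoc[symmetric])
  also have "\<dots> = (?e i * ?e (Suc i)) * (\<sigma> i * ?v)"
    using Suc.IH i by (simp flip: mult.assoc)
  also have "\<dots> = ?v * (?e (Suc i) * ?e (Suc (Suc i)) * \<sigma> (Suc i))"
    unfolding v using ee by (metis mult.assoc)
  finally show ?case by (rule left_cancel)
qed

text \<open>Every pair of strings makes two full turns around each other, so this is the square of the full twist. It
generates the ambiguity in reading a sphere braid with one string at infinity as a planar braid.\<close>

definition all_circuits :: "nat \<Rightarrow> nat list" where
  "all_circuits m = concat (map (circuit m) [1..<Suc m])"

abbreviation "\<Phi> m \<equiv> br (all_circuits m)"

lemma set_all_circuits: "set (all_circuits m) \<subseteq> {1..<m}"
proof
  fix j assume "j \<in> set (all_circuits m)"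
  then obtain k where "1 \<le> k" "k \<le> m" "j \<in> set (circuit m k)"
    by (auto simp: all_circuits_def simp del: upt_Suc)
  then show "j \<in> {1..<m}" using set_circuit by blast
qed

lemma concat_circuits_commute:
  assumes "1 \<le> i" "i < m" "\<And>k. k \<in> set ks \<Longrightarrow> 1 \<le> k \<and> k \<le> m \<and> k \<noteq> i \<and> k \<noteq> Suc i"
  shows "\<sigma> i * br (concat (map (circuit m) ks)) = br (concat (map (circuit m) ks)) * \<sigma> i"
  using assms(3)
proof (induction ks)
  case (Cons k ks)
  have "\<sigma> i * br (circuit m k) = br (circuit m k) * \<sigma> i"
    using Cons.prems[of k] assms by (intro circuit_commute) auto
  moreover have "\<sigma> i * br (concat (map (circuit m) ks)) = br (concat (map (circuit m) ks)) * \<sigma> i"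
    using Cons by simp
  ultimately show ?case by (simp add: br_append) (metis mult.assoc)
qed simp

lemma all_circuits_split:
  assumes "1 \<le> i" "i < m"
  obtains x y where "\<Phi> m = x * (br (circuit m i) * br (circuit m (Suc i))) * y"
    "\<sigma> i * x = x * \<sigma> i" "\<sigma> i * y = y * \<sigma> i"
proof -
  have "[1..<Suc m] = [1..<i] @ [i..<Suc m]" using assms upt_add_eq_append[of 1 i "Suc m - i"] by simp
  also have "[i..<Suc m] = i # Suc i # [Suc (Suc i)..<Suc m]" using assms by (simp add: upt_conv_Cons)
  finally have "\<Phi> m = br (concat (map (circuit m) [1..<i])) * (br (circuit m i) * br (circuit m (Suc i)))
      * br (concat (map (circuit m) [Suc (Suc i)..<Suc m]))"
    unfolding all_circuits_def by (simp add: br_append mult.assoc del: upt_Suc)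
  then show ?thesis
    by (rule that) (intro concat_circuits_commute; use assms in auto)+
qed

lemma all_circuits_central:
  assumes "1 \<le> i" "i < m"
  shows "\<sigma> i * \<Phi> m = \<Phi> m * \<sigma> i"
proof -
  obtain x y where *: "\<Phi> m = x * (br (circuit m i) * br (circuit m (Suc i))) * y"
    "\<sigma> i * x = x * \<sigma> i" "\<sigma> i * y = y * \<sigma> i" using assms by (rule all_circuits_split)
  show ?thesis unfolding *(1) using circuit_pair_commute[OF assms] *(2,3) by (metis mult.assoc)
qed

lemma all_circuits_commute: "set u \<subseteq> {1..<m} \<Longrightarrow> br u * \<Phi> m = \<Phi> m * br u"
  by (intro br_commute_s all_circuits_central) auto

text \<open>The factor \<open>circuit m i\<close> starts with \<open>\<sigma> i\<close>, which commutes with all the factors before it. Divisibility by each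
generator is what gives the generators positive inverses modulo \<open>\<Phi>\<close>.\<close>

lemma all_circuits_divisible:
  assumes "1 \<le> i" "i < m"
  obtains u where "set u \<subseteq> {1..<m}" "\<sigma> i * br u = \<Phi> m" "br u * \<sigma> i = \<Phi> m"
proof -
  obtain x y where *: "\<Phi> m = x * (br (circuit m i) * br (circuit m (Suc i))) * y" "\<sigma> i * x = x * \<sigma> i"
    using assms by (rule all_circuits_split)
  obtain c where "br (circuit m i) = \<sigma> i * c"
    using assms by (simp add: circuit_def upt_conv_Cons br_Cons)
  then have "\<Phi> m = \<sigma> i * (x * (c * br (circuit m (Suc i))) * y)"
    using * by (simp add: mult.assoc) (metis mult.assoc)
  then obtain u where u: "\<Phi> m = \<sigma> i * br u" by (metis br_surj)
  then have "braid_eq (all_circuits m) (i # u)" by (simp add: br_Cons flip: br_eq_iff)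
  then have "set u \<subseteq> {1..<m}" using braid_eq_set set_all_circuits[of m] by fastforce
  moreover have "\<sigma> i * (br u * \<sigma> i) = \<sigma> i * \<Phi> m"
    using u all_circuits_central[OF assms] by (simp add: mult.assoc)
  ultimately show ?thesis using that u by simp
qed

lemma length_circuit: "1 \<le> k \<Longrightarrow> k \<le> m \<Longrightarrow> length (circuit m k) = 2 * (m - 1)"
  by (simp add: circuit_def)

lemma length_all_circuits: "length (all_circuits m) = 2 * m * (m - 1)"
proof -
  have "length (all_circuits m) = sum_list (map (\<lambda>k. length (circuit m k)) [1..<Suc m])"
    by (simp add: all_circuits_def length_concat comp_def del: upt_Suc)
  also have "map (\<lambda>k. length (circuit m k)) [1..<Suc m] = map (\<lambda>k. 2 * (m - 1)) [1..<Suc m]"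
    by (rule map_cong) (auto simp: length_circuit)
  finally show ?thesis by (simp add: sum_list_triv del: upt_Suc)
qed

lemma length_half_twist: "2 * length (half_twist m) = m * (m - 1)"
  by (induction m) (auto simp: algebra_simps)

text \<open>Modulo \<open>\<Phi>\<close> the hypotheses say \<open>p q p = q\<close> and \<open>p\<^sup>4 = 1\<close>. The first one fixes the length of \<open>p\<^sup>2\<close> as that of
the power of \<open>\<Phi>\<close> with exponent \<open>b - a\<close>. The second then says \<open>p\<^sup>4\<close> is the square of that very power, and square
roots are unique. Without the first equation there would be elements of order four modulo \<open>\<Phi>\<close>, such as
the half twist.\<close>

lemma no_torsion_mod_circuits:
  assumes "2 \<le> m" and p: "set p \<subseteq> {1..<m}"
    and conj: "\<Phi> m ^ a * (br p * br q * br p) = \<Phi> m ^ b * br q"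
    and tors: "\<Phi> m ^ c * (br p * br p * (br p * br p)) = \<Phi> m ^ d"
  shows "\<exists>k. br p * br p = \<Phi> m ^ k"
proof -
  define f where "f = length (all_circuits m)"
  have f: "f > 0" using assms(1) by (simp add: f_def length_all_circuits)
  have l1: "a * f + 2 * length p = b * f" using arg_cong[OF conj, of len] by (simp add: f_def)
  have l2: "c * f + 4 * length p = d * f" using arg_cong[OF tors, of len] by (simp add: f_def)
  have "a * f \<le> b * f" using l1 by linarith
  then have ab: "a \<le> b" using f by simp
  have "c * f + 2 * (b * f) = d * f + 2 * (a * f)" using l1 l2 by linarith
  then have "(c + 2 * b) * f = (d + 2 * a) * f" by (simp add: algebra_simps)
  then have "c + 2 * b = d + 2 * a" using f by simp
  then have "d = c + ((b - a) + (b - a))" using ab by linarith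
  then have "\<Phi> m ^ c * (br p * br p * (br p * br p)) = \<Phi> m ^ c * (\<Phi> m ^ (b - a) * \<Phi> m ^ (b - a))"
    using tors by (simp only: power_add)
  then have "br p * br p * (br p * br p) = \<Phi> m ^ (b - a) * \<Phi> m ^ (b - a)"
    by simp
  moreover have "br p * br p * \<Phi> m ^ (b - a) = \<Phi> m ^ (b - a) * (br p * br p)"
    using all_circuits_commute[of "p @ p" m] p power_commuting_commutes[of "\<Phi> m" "br (p @ p)" "b - a"]
    by (simp add: br_append)
  ultimately show ?thesis using square_root_unique by blast
qed

section \<open>Subgroups isomorphic to the quaternion group\<close>

text \<open>Conjugation by \<open>y\<close> inverts \<open>x\<close> but fixes \<open>x\<^sup>2 = y\<^sup>2\<close>, so \<open>x\<^sup>2\<close> is its own inverse.\<close>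

lemma (in group) square_of_quaternion_pair:
  assumes "x \<in> carrier G" "y \<in> carrier G" "x \<otimes> x = y \<otimes> y" "x \<otimes> y \<otimes> x = y"
  shows "x \<otimes> x \<otimes> (x \<otimes> x) = \<one>"
proof -
  have "x \<otimes> x \<otimes> (x \<otimes> x) \<otimes> y = x \<otimes> x \<otimes> (y \<otimes> y) \<otimes> y"
    by (simp only: assms(3))
  also have "\<dots> = x \<otimes> x \<otimes> y \<otimes> (x \<otimes> x)"
    unfolding assms(3) using assms(1,2) by (simp add: m_assoc)
  also have "\<dots> = x \<otimes> (x \<otimes> y \<otimes> x) \<otimes> x"
    using assms(1,2) by (simp add: m_assoc)
  also have "\<dots> = y"
    by (simp only: assms(4))
  finally show ?thesis
    using r_cancel_one[of y "x \<otimes> x \<otimes> (x \<otimes> x)"] assms(1,2) by simp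
qed

definition quaternion_map :: "('a, 'b) monoid_scheme \<Rightarrow> 'a \<Rightarrow> 'a \<Rightarrow> quat \<Rightarrow> 'a" where
  "quaternion_map G x y = (\<lambda>(a, b, c, d).
     let z = x \<otimes>\<^bsub>G\<^esub> x in
     if a = 1 then \<one>\<^bsub>G\<^esub> else if a = -1 then z
     else if b = 1 then x else if b = -1 then z \<otimes>\<^bsub>G\<^esub> x
     else if c = 1 then y else if c = -1 then z \<otimes>\<^bsub>G\<^esub> y
     else if d = 1 then x \<otimes>\<^bsub>G\<^esub> y else z \<otimes>\<^bsub>G\<^esub> (x \<otimes>\<^bsub>G\<^esub> y))"

lemma carrier_Q8: "carrier Q8 = {(1, 0, 0, 0), (-1, 0, 0, 0), (0, 1, 0, 0), (0, -1, 0, 0),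
                   (0, 0, 1, 0), (0, 0, -1, 0), (0, 0, 0, 1), (0, 0, 0, -1)}"
  and mult_Q8: "p \<otimes>\<^bsub>Q8\<^esub> q = quat_mult p q"
  and one_Q8: "\<one>\<^bsub>Q8\<^esub> = (1, 0, 0, 0)"
  by (simp_all add: Q8_def)

text \<open>With \<open>z = x\<^sup>2\<close> the relations bring every product into one of the eight forms listed in \<open>quaternion_map\<close>, so that
map is a homomorphism.\<close>

lemma (in group) contains_Q8I:
  assumes xy: "x \<in> carrier G" "y \<in> carrier G" and sq: "x \<otimes> x = y \<otimes> y"
    and conj: "x \<otimes> y \<otimes> x = y" and nontrivial: "x \<otimes> x \<noteq> \<one>"
  shows "contains_copy_of G Q8"
proof -
  define z where "z = x \<otimes> x"
  have z: "z \<in> carrier G" using xy by (simp add: z_def)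
  have zz: "z \<otimes> z = \<one>"
    using square_of_quaternion_pair[OF xy sq conj] by (simp add: z_def)
  have xx: "x \<otimes> x = z" and yy: "y \<otimes> y = z" using sq by (simp_all add: z_def)
  have xz: "x \<otimes> z = z \<otimes> x" using xy by (simp add: z_def m_assoc)
  have yz: "y \<otimes> z = z \<otimes> y" unfolding z_def sq using xy by (simp add: m_assoc)
  have "y \<otimes> x = z \<otimes> z \<otimes> (y \<otimes> x)" using xy by (simp add: zz)
  also have "\<dots> = z \<otimes> (x \<otimes> (x \<otimes> y \<otimes> x))"
    using xy z by (simp add: z_def m_assoc)
  finally have yx: "y \<otimes> x = z \<otimes> (x \<otimes> y)" by (simp add: conj)
  note base = xx yy zz xz yz yx
  have rules: "x \<otimes> (x \<otimes> w) = z \<otimes> w" "y \<otimes> (y \<otimes> w) = z \<otimes> w" "z \<otimes> (z \<otimes> w) = w"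
    "x \<otimes> (z \<otimes> w) = z \<otimes> (x \<otimes> w)" "y \<otimes> (z \<otimes> w) = z \<otimes> (y \<otimes> w)"
    "y \<otimes> (x \<otimes> w) = z \<otimes> (x \<otimes> (y \<otimes> w))"
    if "w \<in> carrier G" for w
    using that xy z base by (simp_all flip: m_assoc)
  let ?h = "quaternion_map G x y"
  have hom: "?h \<in> hom Q8 G"
  proof (rule homI)
    fix p assume "p \<in> carrier Q8"
    then show "?h p \<in> carrier G"
      using xy by (auto simp: carrier_Q8 quaternion_map_def Let_def)
  next
    fix p q assume "p \<in> carrier Q8" "q \<in> carrier Q8"
    then show "?h (p \<otimes>\<^bsub>Q8\<^esub> q) = ?h p \<otimes> ?h q"
      unfolding carrier_Q8 mult_Q8 insert_iff empty_iff simp_thms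
      by (elim disjE) (simp_all add: quaternion_map_def Let_def base rules xy z m_assoc)
  qed
  interpret h: group_hom Q8 G ?h
    using hom by (simp add: group_hom_def group_hom_axioms_def group_Q8 is_group)
  \<comment> \<open>an element other than \<open>1\<close> and \<open>-1\<close> squares to \<open>-1\<close>, which is sent to \<open>z \<noteq> \<one>\<close>\<close>
  have "p = \<one>\<^bsub>Q8\<^esub>" if "p \<in> carrier Q8" "?h p = \<one>" for p
  proof (rule ccontr)
    assume p: "p \<noteq> \<one>\<^bsub>Q8\<^esub>"
    have m1: "(-1, 0, 0, 0) \<in> carrier Q8" "?h (-1, 0, 0, 0) = z"
      by (simp_all add: carrier_Q8 quaternion_map_def z_def)
    have "p = (-1, 0, 0, 0) \<or> p \<otimes>\<^bsub>Q8\<^esub> p = (-1, 0, 0, 0)"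
      using that(1) p by (auto simp: carrier_Q8 mult_Q8 one_Q8)
    moreover have "?h (p \<otimes>\<^bsub>Q8\<^esub> p) = \<one>" using that by (simp add: h.hom_mult)
    ultimately show False using that(2) m1(2) nontrivial unfolding z_def by metis
  qed
  then have inj: "inj_on ?h (carrier Q8)" unfolding h.inj_on_one_iff by blast
  have "?h \<in> iso Q8 (G\<lparr>carrier := ?h ` carrier Q8\<rparr>)"
    using hom inj by (auto simp: iso_def hom_def bij_betw_def)
  then have "G\<lparr>carrier := ?h ` carrier Q8\<rparr> \<cong> Q8"
    using group.iso_sym[OF group_Q8 is_isoI] by blast
  then show ?thesis
    unfolding contains_copy_of_def using h.img_is_subgroup by blast
qed

lemma (in group) contains_Q8E:
  assumes "contains_copy_of G Q8"
  obtains x y where "x \<in> carrier G" "y \<in> carrier G" "x \<otimes> x = y \<otimes> y"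
    "x \<otimes> y \<otimes> x = y" "x \<otimes> x \<noteq> \<one>"
proof -
  obtain H where H: "subgroup H G" and "G\<lparr>carrier := H\<rparr> \<cong> Q8"
    using assms by (auto simp: contains_copy_of_def)
  then have "Q8 \<cong> G\<lparr>carrier := H\<rparr>"
    using group.iso_sym subgroup_imp_group by blast
  then obtain h where h: "h \<in> hom Q8 (G\<lparr>carrier := H\<rparr>)" "bij_betw h (carrier Q8) H"
    by (auto simp: is_iso_def iso_def)
  have "h \<in> hom Q8 G"
    using h(1) subgroup.subset[OF H] by (auto simp: hom_def)
  then interpret h: group_hom Q8 G h
    by (simp add: group_hom_def group_hom_axioms_def group_Q8 is_group)
  let ?i = "(0, 1, 0, 0) :: quat" and ?j = "(0, 0, 1, 0) :: quat" and ?m = "(-1, 0, 0, 0) :: quat"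
  have c: "?i \<in> carrier Q8" "?j \<in> carrier Q8" "?m \<in> carrier Q8" "\<one>\<^bsub>Q8\<^esub> \<in> carrier Q8"
    by (simp_all add: carrier_Q8 one_Q8)
  have "h ?i \<otimes> h ?i = h ?m" "h ?j \<otimes> h ?j = h ?m"
    using c by (simp_all add: mult_Q8 flip: h.hom_mult)
  moreover have "h ?i \<otimes> h ?j \<otimes> h ?i = h ?j"
    using c h.hom_mult[of "?i \<otimes>\<^bsub>Q8\<^esub> ?j" ?i] group.is_monoid[OF group_Q8]
    by (simp add: monoid.m_closed flip: h.hom_mult) (simp add: mult_Q8)
  moreover have "h ?m \<noteq> h \<one>\<^bsub>Q8\<^esub>"
    using h(2) c unfolding bij_betw_def inj_on_def by (metis one_Q8 prod.inject zero_neq_one neg_equal_0_iff_equal one_neq_neg_one)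
  ultimately show ?thesis using that[of "h ?i" "h ?j"] c by simp
qed

section \<open>A fixed point of the quaternion group on an odd set\<close>

lemma odd_fixed_points_involution:
  assumes "finite A" "odd (card A)" "\<And>a. a \<in> A \<Longrightarrow> f a \<in> A" "\<And>a. a \<in> A \<Longrightarrow> f (f a) = a"
  shows "odd (card {a \<in> A. f a = a})"
  using assms
proof (induction "card A" arbitrary: A rule: less_induct)
  case less
  show ?case
  proof (cases "\<exists>a\<in>A. f a \<noteq> a")
    case False
    then have "{a \<in> A. f a = a} = A" by auto
    then show ?thesis using less by simp
  next
    case True
    then obtain a where a: "a \<in> A" "f a \<noteq> a" by blast
    let ?B = "A - {a, f a}"
    have sub: "{a, f a} \<subseteq> A" using a less by auto
    have card: "card A = card ?B + 2"
      using card_Diff_subset[of "{a, f a}" A] card_mono[OF _ sub] less sub a(2) by auto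
    have "odd (card {b \<in> ?B. f b = b})"
    proof (rule less.hyps)
      fix b assume b: "b \<in> ?B"
      then show "f b \<in> ?B" using less.prems a by (metis DiffD1 DiffD2 DiffI insertE insertI1 insertI2 singletonD)
      show "f (f b) = b" using b less.prems by blast
    qed (use card less.prems in auto)
    moreover have "{b \<in> ?B. f b = b} = {a \<in> A. f a = a}"
      using a less.prems by auto
    ultimately show ?thesis by simp
  qed
qed

text \<open>Involutions of a set of odd size have an odd number of fixed points. This is applied three times: \<open>f \<circ> f = g \<circ> g\<close>
is an involution, \<open>f\<close> is an involution on its fixed points, and \<open>g\<close> preserves the fixed points of \<open>f\<close> and is an involution there.\<close>

lemma quaternion_common_fixed_point:
  assumes A: "finite A" "odd (card A)" and closed: "\<And>a. a \<in> A \<Longrightarrow> f a \<in> A" "\<And>a. a \<in> A \<Longrightarrow> g a \<in> A"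
    and four: "\<And>a. a \<in> A \<Longrightarrow> f (f (f (f a))) = a"
    and sq: "\<And>a. a \<in> A \<Longrightarrow> f (f a) = g (g a)"
    and conj: "\<And>a. a \<in> A \<Longrightarrow> f (g (f a)) = g a"
  obtains a where "a \<in> A" "f a = a" "g a = a"
proof -
  define B where "B = {a \<in> A. f (f a) = a}"
  define C where "C = {a \<in> B. f a = a}"
  have "odd (card B)"
    unfolding B_def using A closed four by (intro odd_fixed_points_involution) auto
  then have "odd (card C)"
    unfolding C_def using A closed by (intro odd_fixed_points_involution) (auto simp: B_def)
  then have "odd (card {a \<in> C. g a = a})"
    using A closed sq conj by (intro odd_fixed_points_involution) (auto simp: B_def C_def, metis+)
  then have "{a \<in> C. g a = a} \<noteq> {}" by (metis card.empty even_zero)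
  then show ?thesis using that by (auto simp: B_def C_def)
qed

section \<open>Positive words in presented groups\<close>

text \<open>The generating sets below are intervals starting at \<open>1\<close>; they keep one form for rewriting.\<close>

declare One_nat_def [simp del]

definition pos_class :: "nat set \<Rightarrow> (nat word \<times> nat word) set \<Rightarrow> nat list \<Rightarrow> nat word set" where
  "pos_class X R u = pres_rel X R `` {pos_word u}"

lemma pos_word_simps [simp]: "pos_word [] = []" "pos_word (i # u) = (i, True) # pos_word u"
    "pos_word (u @ v) = pos_word u @ pos_word v"
  by (simp_all add: pos_word_def)

lemma pos_word_words [simp]: "pos_word u \<in> words X \<longleftrightarrow> set u \<subseteq> X"
  by (induction u) auto

lemma pos_class_closed: "set u \<subseteq> X \<Longrightarrow> pos_class X R u \<in> carrier (presented_group X R)"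
  by (simp add: pos_class_def presented_group_class_closed)

lemma pos_class_append: "set u \<subseteq> X \<Longrightarrow> set v \<subseteq> X \<Longrightarrow>
    pos_class X R (u @ v) = pos_class X R u \<otimes>\<^bsub>presented_group X R\<^esub> pos_class X R v"
  by (simp add: pos_class_def presented_group_mult)

lemma pos_class_Nil: "pos_class X R [] = \<one>\<^bsub>presented_group X R\<^esub>"
  by (simp add: pos_class_def presented_group_one)

lemma pos_class_eq_iff: "set u \<subseteq> X \<Longrightarrow> set v \<subseteq> X \<Longrightarrow>
    pos_class X R u = pos_class X R v \<longleftrightarrow> (pos_word u, pos_word v) \<in> pres_rel X R"
  by (simp add: pos_class_def pres_class_eq_iff)

lemma eval_pos_class:
  assumes "set u \<subseteq> X"
  shows "eval_word (presented_group X R) (\<lambda>i. pos_class X R [i]) (pos_word u) = pos_class X R u"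
  using assms
proof (induction u)
  case (Cons i u)
  then show ?case using pos_class_append[of "[i]" X u R] by simp
qed (simp add: pos_class_Nil)

definition braid_presentation :: "nat set \<Rightarrow> (nat word \<times> nat word) set \<Rightarrow> bool" where
  "braid_presentation X R \<longleftrightarrow>
     (\<forall>i\<in>X. \<forall>j\<in>X. far i j \<longrightarrow> (pos_word [i, j], pos_word [j, i]) \<in> R) \<and>
     (\<forall>i. i \<in> X \<and> Suc i \<in> X \<longrightarrow> (pos_word [i, Suc i, i], pos_word [Suc i, i, Suc i]) \<in> R)"

text \<open>This transfers every identity between positive braids to the presented groups, as braid relations never leave the set
of letters of a word.\<close>

lemma pos_class_braid_eq:
  assumes R: "braid_presentation X R" and "br u = br v" "set u \<subseteq> X"
  shows "pos_class X R u = pos_class X R v"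
proof -
  have uv: "braid_eq u v" using assms(2) by (simp add: br_eq_iff)
  then have "(pos_word u, pos_word v) \<in> pres_rel X R"
    using \<open>set u \<subseteq> X\<close>
  proof (induction rule: braid_eq.induct)
    case (comm i j x y)
    then have "(pos_word [i, j], pos_word [j, i]) \<in> pres_rel X R"
      using R by (intro pres_rel.rel) (auto simp: braid_presentation_def)
    then have "(pos_word x @ pos_word [i, j] @ pos_word y, pos_word x @ pos_word [j, i] @ pos_word y) \<in> pres_rel X R"
      using comm by (intro pres_rel.mult pres_rel.refl) auto
    then show ?case by simp
  next
    case (braid i j x y)
    have 1: "(pos_word [i, Suc i, i], pos_word [Suc i, i, Suc i]) \<in> pres_rel X R"
      if "i \<in> X" "Suc i \<in> X" for i
      using R that by (intro pres_rel.rel) (auto simp: braid_presentation_def)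
    have "(pos_word [i, j, i], pos_word [j, i, j]) \<in> pres_rel X R"
      using braid 1[of i] 1[of j] pres_rel.sym by (auto simp: adj_def)
    then have "(pos_word x @ pos_word [i, j, i] @ pos_word y, pos_word x @ pos_word [j, i, j] @ pos_word y) \<in> pres_rel X R"
      using braid by (intro pres_rel.mult pres_rel.refl) auto
    then show ?case by simp
  next
    case (refl u)
    then show ?case by (simp add: pres_rel.refl)
  next
    case (sym u v)
    then show ?case using braid_eq_set[OF sym.hyps] by (simp add: pres_rel.sym)
  next
    case (trans u v w)
    have "set v \<subseteq> X" using trans.prems braid_eq_set[OF trans.hyps(1)] by simp
    then show ?case using trans.IH trans.prems by (blast intro: pres_rel.trans)
  qed
  then show ?thesis
    using assms(3) braid_eq_set[OF uv] by (subst pos_class_eq_iff) auto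
qed

section \<open>Planar braids modulo all circuits\<close>

definition circuit_relations :: "nat \<Rightarrow> (nat word \<times> nat word) set" where
  "circuit_relations m =
     {(pos_word [i, j], pos_word [j, i]) | i j. i \<in> {1..<m} \<and> j \<in> {1..<m} \<and> far i j} \<union>
     {(pos_word [i, Suc i, i], pos_word [Suc i, i, Suc i]) | i. i \<in> {1..<m} \<and> Suc i \<in> {1..<m}} \<union>
     {(pos_word (all_circuits m), [])}"

text \<open>The braid group of the plane on \<open>m\<close> strings modulo \<open>\<Phi>\<close>.\<close>

definition planar_quotient :: "nat \<Rightarrow> nat word set monoid" where
  "planar_quotient m = presented_group {1..<m} (circuit_relations m)"

abbreviation planar_class :: "nat \<Rightarrow> nat list \<Rightarrow> nat word set" where
  "planar_class m \<equiv> pos_class {1..<m} (circuit_relations m)"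

lemma braid_presentation_circuit: "braid_presentation {1..<m} (circuit_relations m)"
  unfolding braid_presentation_def circuit_relations_def by blast

lemma group_planar_quotient: "group (planar_quotient m)"
  by (simp add: planar_quotient_def group_presented_group)

lemma planar_class_closed: "set u \<subseteq> {1..<m} \<Longrightarrow> planar_class m u \<in> carrier (planar_quotient m)"
  by (simp add: planar_quotient_def pos_class_closed)

lemma planar_class_append: "set u \<subseteq> {1..<m} \<Longrightarrow> set v \<subseteq> {1..<m} \<Longrightarrow>
    planar_class m (u @ v) = planar_class m u \<otimes>\<^bsub>planar_quotient m\<^esub> planar_class m v"
  by (simp add: planar_quotient_def pos_class_append)

lemma planar_class_Nil: "planar_class m [] = \<one>\<^bsub>planar_quotient m\<^esub>"
  by (simp add: planar_quotient_def pos_class_Nil)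

lemma planar_class_braid_eq: "br u = br v \<Longrightarrow> set u \<subseteq> {1..<m} \<Longrightarrow> planar_class m u = planar_class m v"
  by (rule pos_class_braid_eq[OF braid_presentation_circuit])

lemma planar_class_all_circuits: "planar_class m (all_circuits m) = \<one>\<^bsub>planar_quotient m\<^esub>"
proof -
  have "(pos_word (all_circuits m), pos_word []) \<in> pres_rel {1..<m} (circuit_relations m)"
    using set_all_circuits by (intro pres_rel.rel) (auto simp: circuit_relations_def)
  then show ?thesis
    using set_all_circuits by (simp add: pos_class_eq_iff flip: planar_class_Nil)
qed

definition positive_inverse :: "nat \<Rightarrow> nat \<Rightarrow> nat list" where
  "positive_inverse m i = (SOME u. set u \<subseteq> {1..<m} \<and> \<sigma> i * br u = \<Phi> m \<and> br u * \<sigma> i = \<Phi> m)"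

lemma positive_inverse:
  assumes "i \<in> {1..<m}"
  shows "set (positive_inverse m i) \<subseteq> {1..<m}" "\<sigma> i * br (positive_inverse m i) = \<Phi> m"
    "br (positive_inverse m i) * \<sigma> i = \<Phi> m"
proof -
  have "\<exists>u. set u \<subseteq> {1..<m} \<and> \<sigma> i * br u = \<Phi> m \<and> br u * \<sigma> i = \<Phi> m"
    using assms all_circuits_divisible[of i m] by (metis atLeastLessThan_iff)
  from someI_ex[OF this] show "set (positive_inverse m i) \<subseteq> {1..<m}"
    "\<sigma> i * br (positive_inverse m i) = \<Phi> m" "br (positive_inverse m i) * \<sigma> i = \<Phi> m"
    unfolding positive_inverse_def by blast+
qed

text \<open>As \<open>\<Phi>\<close> becomes trivial and each generator divides it, inverse letters can be replaced by positive words.\<close>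

fun positive_form :: "nat \<Rightarrow> nat word \<Rightarrow> nat list" where
  "positive_form m [] = []"
| "positive_form m ((i, b) # w) = (if b then [i] else positive_inverse m i) @ positive_form m w"

lemma positive_form_append: "positive_form m (u @ v) = positive_form m u @ positive_form m v"
  by (induction u) auto

lemma positive_form_pos_word: "positive_form m (pos_word u) = u"
  by (induction u) auto

lemma set_positive_form: "w \<in> words {1..<m} \<Longrightarrow> set (positive_form m w) \<subseteq> {1..<m}"
proof (induction w)
  case (Cons a w)
  obtain i b where a: "a = (i, b)" by fastforce
  then show ?case using Cons positive_inverse(1)[of i m] by auto
qed simp

lemma powers_of_all_circuits_commute:
  assumes "set u \<subseteq> {1..<m}"
  shows "br u * \<Phi> m ^ a = \<Phi> m ^ a * br u"
  using power_commuting_commutes[OF all_circuits_commute[OF assms, symmetric]] by simp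

text \<open>The word problem of the planar quotient reduces to equality of positive braids up to powers of \<open>\<Phi>\<close>. Powers on both sides make
this relation transitive, and centrality of \<open>\<Phi>\<close> makes it compatible with products.\<close>

lemma positive_form_sound:
  assumes "(u, v) \<in> pres_rel {1..<m} (circuit_relations m)"
  shows "\<exists>a b. \<Phi> m ^ a * br (positive_form m u) = \<Phi> m ^ b * br (positive_form m v)"
  using assms
proof induction
  case (rel u v)
  then consider i j where "u = pos_word [i, j]" "v = pos_word [j, i]" "far i j"
    | i where "u = pos_word [i, Suc i, i]" "v = pos_word [Suc i, i, Suc i]"
    | "u = pos_word (all_circuits m)" "v = pos_word []"
    by (auto simp: circuit_relations_def)
  then show ?case
  proof cases
    case 1
    then have "br (positive_form m u) = br (positive_form m v)"
      unfolding positive_form_pos_word using s_far by (simp add: br_Cons)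
    then show ?thesis by metis
  next
    case 2
    then have "br (positive_form m u) = br (positive_form m v)"
      unfolding positive_form_pos_word using s_adj[of _ "Suc _"] by (simp add: br_Cons adj_def)
    then show ?thesis by metis
  next
    case 3
    then have "\<Phi> m ^ 0 * br (positive_form m u) = \<Phi> m ^ 1 * br (positive_form m v)"
      by (simp add: positive_form_pos_word del: pos_word_simps)
    then show ?thesis by metis
  qed
next
  case (cancel i b)
  have "\<Phi> m ^ 0 * br (positive_form m [(i, b), (i, \<not> b)]) = \<Phi> m ^ 1 * br (positive_form m [])"
    using positive_inverse(2,3)[OF cancel] by (cases b) (simp_all add: br_append br_Cons)
  then show ?case by blast
next
  case (refl u)
  show ?case by blast
next
  case (sym u v)
  then show ?case by metis
next
  case (trans u v w)
  then obtain a b c d where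
    "\<Phi> m ^ a * br (positive_form m u) = \<Phi> m ^ b * br (positive_form m v)"
    "\<Phi> m ^ c * br (positive_form m v) = \<Phi> m ^ d * br (positive_form m w)" by blast
  then have "\<Phi> m ^ (c + a) * br (positive_form m u) = \<Phi> m ^ (b + d) * br (positive_form m w)"
    by (metis add.commute mult.assoc power_add)
  then show ?case by blast
next
  case (mult u u' v v')
  then obtain a b c d where eq:
    "\<Phi> m ^ a * br (positive_form m u) = \<Phi> m ^ b * br (positive_form m u')"
    "\<Phi> m ^ c * br (positive_form m v) = \<Phi> m ^ d * br (positive_form m v')" by blast
  have comm: "br (positive_form m u) * \<Phi> m ^ c = \<Phi> m ^ c * br (positive_form m u)"
    "br (positive_form m u') * \<Phi> m ^ d = \<Phi> m ^ d * br (positive_form m u')"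
    using mult pres_rel_words by (blast intro!: powers_of_all_circuits_commute set_positive_form)+
  have "\<Phi> m ^ (a + c) * br (positive_form m (u @ v))
      = \<Phi> m ^ a * br (positive_form m u) * (\<Phi> m ^ c * br (positive_form m v))"
    using comm(1) by (simp add: power_add positive_form_append br_append) (metis mult.assoc)
  also have "\<dots> = \<Phi> m ^ (b + d) * br (positive_form m (u' @ v'))"
    unfolding eq using comm(2) by (simp add: power_add positive_form_append br_append) (metis mult.assoc)
  finally show ?case by blast
qed

lemma planar_class_eqD:
  assumes "planar_class m u = planar_class m v" "set u \<subseteq> {1..<m}" "set v \<subseteq> {1..<m}"
  shows "\<exists>a b. \<Phi> m ^ a * br u = \<Phi> m ^ b * br v"
  using positive_form_sound[of "pos_word u" "pos_word v" m] assms
  by (simp add: pos_class_eq_iff positive_form_pos_word)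

lemma class_positive_form:
  assumes "w \<in> words {1..<m}"
  shows "pres_rel {1..<m} (circuit_relations m) `` {w} = planar_class m (positive_form m w)"
proof -
  let ?r = "pres_rel {1..<m} (circuit_relations m)"
  have "(w, pos_word (positive_form m w)) \<in> ?r"
    using assms
  proof (induction w)
    case (Cons a w)
    obtain i b where a: "a = (i, b)" by fastforce
    have i: "i \<in> {1..<m}" and w: "w \<in> words {1..<m}" using Cons.prems a by auto
    have "([a], pos_word (if b then [i] else positive_inverse m i)) \<in> ?r"
    proof (cases b)
      case True
      then show ?thesis using i a by (auto intro: pres_rel.refl)
    next
      case False
      let ?c = "pos_word (positive_inverse m i)"
      have c: "?c \<in> words {1..<m}" using positive_inverse(1)[OF i] by simp
      have "planar_class m (i # positive_inverse m i) = planar_class m (all_circuits m)"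
        using positive_inverse(1,2)[OF i] i by (intro planar_class_braid_eq) (auto simp: br_Cons)
      then have "planar_class m (i # positive_inverse m i) = planar_class m []"
        by (simp only: planar_class_all_circuits planar_class_Nil)
      then have "((i, True) # ?c, []) \<in> ?r"
        using i c by (simp add: pos_class_eq_iff)
      \<comment> \<open>insert \<open>\<Phi>\<close>, split off as the letter \<open>i\<close> and its positive inverse, and cancel\<close>
      then have "([a] @ ((i, True) # ?c), [a] @ []) \<in> ?r"
        using i a by (intro pres_rel.mult pres_rel.refl) auto
      moreover have "([(i, False), (i, \<not> False)] @ ?c, [] @ ?c) \<in> ?r"
        using i c by (intro pres_rel.mult pres_rel.refl pres_rel.cancel) auto
      ultimately have "([a], ?c) \<in> ?r"
        using a False by (auto intro: pres_rel.trans pres_rel.sym)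
      then show ?thesis using False by simp
    qed
    then have "([a] @ w, pos_word (if b then [i] else positive_inverse m i) @ pos_word (positive_form m w)) \<in> ?r"
      using Cons.IH w by (intro pres_rel.mult)
    then show ?case by (simp add: a)
  qed (simp add: pres_rel.refl)
  then show ?thesis
    unfolding pos_class_def using equiv_class_eq[OF equiv_pres_rel] by blast
qed

lemma planar_class_cases:
  assumes "x \<in> carrier (planar_quotient m)"
  obtains u where "set u \<subseteq> {1..<m}" "x = planar_class m u"
  using assms unfolding planar_quotient_def
  by (metis presented_group_carrier_cases class_positive_form set_positive_form)

lemma planar_class_circuit_power:
  assumes "br u = \<Phi> m ^ k" "set u \<subseteq> {1..<m}"
  shows "planar_class m u = \<one>\<^bsub>planar_quotient m\<^esub>"
proof -
  interpret group "planar_quotient m" by (rule group_planar_quotient)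
  let ?p = "\<lambda>k. concat (replicate k (all_circuits m))"
  have set: "set (?p k) \<subseteq> {1..<m}" for k
    using set_all_circuits by (induction k) auto
  have "br (?p k) = \<Phi> m ^ k"
    by (induction k) (simp_all add: br_append)
  moreover have "planar_class m (?p k) = \<one>\<^bsub>planar_quotient m\<^esub>"
  proof (induction k)
    case (Suc k)
    then show ?case using planar_class_append[OF set_all_circuits set, of k] by (simp add: planar_class_all_circuits)
  qed (simp add: planar_class_Nil)
  ultimately show ?thesis using planar_class_braid_eq[of u "?p k" m] assms by simp
qed

lemma planar_quotient_quaternion_pair:
  assumes "2 \<le> m" and pq: "p \<in> carrier (planar_quotient m)" "q \<in> carrier (planar_quotient m)"
    and conj: "p \<otimes>\<^bsub>planar_quotient m\<^esub> q \<otimes>\<^bsub>planar_quotient m\<^esub> p = q"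
    and four: "p \<otimes>\<^bsub>planar_quotient m\<^esub> p \<otimes>\<^bsub>planar_quotient m\<^esub> (p \<otimes>\<^bsub>planar_quotient m\<^esub> p) = \<one>\<^bsub>planar_quotient m\<^esub>"
  shows "p \<otimes>\<^bsub>planar_quotient m\<^esub> p = \<one>\<^bsub>planar_quotient m\<^esub>"
proof -
  obtain u where u: "set u \<subseteq> {1..<m}" "p = planar_class m u" using pq(1) by (rule planar_class_cases)
  obtain v where v: "set v \<subseteq> {1..<m}" "q = planar_class m v" using pq(2) by (rule planar_class_cases)
  have "planar_class m ((u @ v) @ u) = planar_class m v"
    using conj u v by (simp add: planar_class_append del: append_assoc)
  then obtain a b where "\<Phi> m ^ a * br ((u @ v) @ u) = \<Phi> m ^ b * br v"
    using u v planar_class_eqD[of m "(u @ v) @ u" v] by auto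
  moreover have "planar_class m ((u @ u) @ (u @ u)) = planar_class m []"
    using four u by (simp add: planar_class_append planar_class_Nil del: append_assoc)
  then obtain c d where "\<Phi> m ^ c * br ((u @ u) @ (u @ u)) = \<Phi> m ^ d * br []"
    using u planar_class_eqD[of m "(u @ u) @ (u @ u)" "[]"] by auto
  ultimately obtain k where "br u * br u = \<Phi> m ^ k"
    using no_torsion_mod_circuits[OF assms(1) u(1), of a v b c d] by (auto simp only: br_append br_Nil mult_1_right)
  then have "planar_class m (u @ u) = \<one>\<^bsub>planar_quotient m\<^esub>"
    using u by (intro planar_class_circuit_power) (auto simp: br_append)
  then show ?thesis using u by (simp add: planar_class_append)
qed

text \<open>The full twist has half the length of \<open>\<Phi>\<close>.\<close>

lemma planar_class_half_twist_square:
  assumes "2 \<le> m"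
  shows "planar_class m (half_twist m @ half_twist m) \<noteq> \<one>\<^bsub>planar_quotient m\<^esub>"
proof
  assume "planar_class m (half_twist m @ half_twist m) = \<one>\<^bsub>planar_quotient m\<^esub>"
  then have "planar_class m (half_twist m @ half_twist m) = planar_class m []" by (simp add: planar_class_Nil)
  then obtain a b where "\<Phi> m ^ a * br (half_twist m @ half_twist m) = \<Phi> m ^ b * br []"
    using planar_class_eqD[of m "half_twist m @ half_twist m" "[]"] set_half_twist[of m] by auto
  then have "len (\<Phi> m ^ a * br (half_twist m @ half_twist m)) = len (\<Phi> m ^ b * br [])" by simp
  then have "a * (2 * m * (m - 1)) + 2 * length (half_twist m) = b * (2 * m * (m - 1))"
    by (simp add: length_all_circuits)
  then have "(2 * a + 1) * (m * (m - 1)) = (2 * b) * (m * (m - 1))"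
    unfolding length_half_twist by (simp add: algebra_simps)
  then have "2 * a + 1 = 2 * b" using assms by simp
  then show False by presburger
qed

section \<open>The marked string moving on by one position\<close>

text \<open>In the sphere braid group \<open>circuit (Suc m) k\<close> is trivial, and the equation computes what happens when the marked string
moves on from position \<open>k\<close> to position \<open>k + 1\<close>.\<close>

lemma circuit_next:
  assumes "1 \<le> k" "k \<le> m"
  shows "br ([k] @ [k..<Suc m] @ circuit m k) = br (circuit (Suc m) k @ [Suc k..<Suc m])"
proof -
  let ?r = "up k (Suc m)" and ?r' = "up (Suc k) (Suc m)" and ?\<beta> = "down 1 k * up 1 k"
  have r: "?r = \<sigma> k * ?r'" using assms by (simp add: upt_conv_Cons br_Cons del: upt_Suc)
  have d: "down k (Suc m) = down (Suc k) (Suc m) * \<sigma> k"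
    using assms by (simp add: upt_conv_Cons br_Cons br_append del: upt_Suc)
  have map: "map Suc [k..<m] = [Suc k..<Suc m]" by (simp add: map_Suc_upt)
  have "?r * up k m = br (map Suc [k..<m]) * ?r" by (rule up_shift_br) auto
  then have sh1: "?r * up k m = ?r' * ?r" by (simp only: map)
  have "?r * down k m = br (map Suc (rev [k..<m])) * ?r" by (rule up_shift_br) auto
  then have sh2: "?r * down k m = down (Suc k) (Suc m) * ?r" by (simp only: map flip: rev_map)
  have "br [Suc k..<Suc m] * br (rev [1..<k] @ [1..<k]) = br (rev [1..<k] @ [1..<k]) * br [Suc k..<Suc m]"
    by (rule br_br_far) (auto simp: far_def)
  then have far: "?r' * ?\<beta> = ?\<beta> * ?r'" by (simp only: br_append)
  have "br ([k] @ [k..<Suc m] @ circuit m k) = \<sigma> k * (?r * up k m) * down k m * ?\<beta>"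
    unfolding br_append br_circuit[OF assms] by (simp only: mult.assoc s_eq)
  also have "\<dots> = \<sigma> k * ?r' * (?r * down k m) * ?\<beta>"
    unfolding sh1 by (simp only: mult.assoc)
  also have "\<dots> = ?r * down (Suc k) (Suc m) * \<sigma> k * (?r' * ?\<beta>)"
    unfolding sh2 r[symmetric] by (simp only: mult.assoc) (simp only: r mult.assoc)
  also have "\<dots> = br (circuit (Suc m) k @ [Suc k..<Suc m])"
    unfolding far br_append using assms by (subst br_circuit) (simp_all only: d mult.assoc le_SucI)
  finally show ?thesis .
qed

section \<open>Groups of bijections\<close>

definition bijections :: "('s \<Rightarrow> 's) monoid" where
  "bijections = \<lparr>carrier = {f. bij f}, mult = (\<circ>), one = id\<rparr>"

lemma bijections_simps [simp]: "f \<in> carrier bijections \<longleftrightarrow> bij f" "f \<otimes>\<^bsub>bijections\<^esub> g = f \<circ> g"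
    "\<one>\<^bsub>bijections\<^esub> = id"
  by (simp_all add: bijections_def)

lemma group_bijections: "group bijections"
proof (rule groupI)
  fix f :: "'s \<Rightarrow> 's" assume "f \<in> carrier bijections"
  then show "\<exists>g\<in>carrier bijections. g \<otimes>\<^bsub>bijections\<^esub> f = \<one>\<^bsub>bijections\<^esub>"
    by (metis bij_betw_def bij_imp_bij_inv bijections_simps inv_o_cancel)
qed (auto simp: bij_comp comp_assoc)

lemma inv_bijections: "g \<circ> f = id \<Longrightarrow> bij f \<Longrightarrow> bij g \<Longrightarrow> inv\<^bsub>bijections\<^esub> f = g"
  using group.inv_equality[OF group_bijections, of g f] by simp

lemma (in group) inv_intertwine:
  assumes "a \<in> carrier G" "b \<in> carrier G" "c \<in> carrier G" "a \<otimes> b = b \<otimes> c"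
  shows "inv a \<otimes> b = b \<otimes> inv c"
proof -
  have "inv a \<otimes> b = inv a \<otimes> (b \<otimes> c) \<otimes> inv c" using assms(1-3) by (simp add: m_assoc)
  also have "\<dots> = b \<otimes> inv c" unfolding assms(4)[symmetric] using assms(1-3) by (simp add: m_assoc[symmetric])
  finally show ?thesis .
qed

section \<open>Sphere braids\<close>

text \<open>Sphere braids on \<open>m + 1\<close> strings, one of which is marked; the others form the planar braids on \<open>m\<close> strings.\<close>

locale sphere_braids =
  fixes m :: nat
  assumes m: "2 \<le> m"
begin

abbreviation "SB \<equiv> sphere_braid_group (Suc m)"
abbreviation "PQ \<equiv> planar_quotient m"
abbreviation "relS \<equiv> sphere_braid_relations (Suc m)"
abbreviation sphere_class :: "nat list \<Rightarrow> nat word set" where "sphere_class \<equiv> pos_class {1..m} relS"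

sublocale S: group SB by (rule group_sphere_braid_group)
sublocale Q: group PQ by (rule group_planar_quotient)

abbreviation mult_S (infixl "\<cdot>" 70) where "x \<cdot> y \<equiv> x \<otimes>\<^bsub>SB\<^esub> y"
abbreviation mult_Q (infixl "\<star>" 70) where "x \<star> y \<equiv> x \<otimes>\<^bsub>PQ\<^esub> y"

lemma SB_eq: "SB = presented_group {1..m} relS"
  by (simp add: sphere_braid_group_def)

lemma sphere_class_closed [simp]: "set u \<subseteq> {1..m} \<Longrightarrow> sphere_class u \<in> carrier SB"
  by (simp add: SB_eq pos_class_closed)

lemma sphere_class_append: "set u \<subseteq> {1..m} \<Longrightarrow> set v \<subseteq> {1..m} \<Longrightarrow> sphere_class (u @ v) = sphere_class u \<cdot> sphere_class v"
  by (simp add: SB_eq pos_class_append)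

lemma sphere_class_Nil: "sphere_class [] = \<one>\<^bsub>SB\<^esub>"
  by (simp add: SB_eq pos_class_Nil)

lemma sphere_class_braid_eq:
  assumes "br u = br v" "set u \<subseteq> {1..m}"
  shows "sphere_class u = sphere_class v"
proof (rule pos_class_braid_eq)
  show "braid_presentation {1..m} relS"
    unfolding braid_presentation_def sphere_braid_relations_def far_def by fastforce
qed (use assms in auto)

lemma sphere_word: "[1..<Suc m - 1] @ [Suc m - 1, Suc m - 1] @ rev [1..<Suc m - 1] = circuit (Suc m) 1"
  using m by (simp add: circuit_def)

lemma set_circuit_Suc: "1 \<le> k \<Longrightarrow> k \<le> Suc m \<Longrightarrow> set (circuit (Suc m) k) \<subseteq> {1..m}"
  using set_circuit[of k "Suc m"] by (auto simp: atLeastLessThanSuc_atLeastAtMost)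

text \<open>The words in question are the cyclic rotations of the sphere relation.\<close>

lemma sphere_class_circuit:
  assumes "1 \<le> k" "k \<le> Suc m"
  shows "sphere_class (circuit (Suc m) k) = \<one>\<^bsub>SB\<^esub>"
proof -
  have "(pos_word (circuit (Suc m) 1), []) \<in> pres_rel {1..m} relS"
    using set_circuit_Suc[of 1]
    using sphere_word by (intro pres_rel.rel) (simp_all add: sphere_braid_relations_def)
  then have 1: "sphere_class (circuit (Suc m) 1) = \<one>\<^bsub>SB\<^esub>"
    using set_circuit_Suc[of 1] by (simp add: pos_class_eq_iff flip: sphere_class_Nil)
  let ?u = "[1..<k]" and ?v = "[k..<Suc m] @ rev [1..<Suc m]"
  have u: "set ?u \<subseteq> {1..m}" and v: "set ?v \<subseteq> {1..m}" using assms by auto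
  have "[1..<Suc m] = [1..<k] @ [k..<Suc m]" using assms upt_add_eq_append[of 1 k "Suc m - k"] by simp
  then have "circuit (Suc m) 1 = ?u @ ?v" by (simp add: circuit_def del: upt_Suc)
  then have "sphere_class ?u \<cdot> sphere_class ?v = \<one>\<^bsub>SB\<^esub>" using 1 sphere_class_append[OF u v] by simp
  then have "sphere_class ?v \<cdot> sphere_class ?u = \<one>\<^bsub>SB\<^esub>" using S.inv_comm sphere_class_closed u v by blast
  then show ?thesis using sphere_class_append[OF v u] by (simp add: circuit_def del: upt_Suc)
qed

text \<open>The coset representative that brings the marked string from position \<open>k\<close> to the last position.\<close>

definition \<rho> :: "nat \<Rightarrow> nat word set" where "\<rho> k = sphere_class [k..<Suc m]"

lemma \<rho>_closed [simp]: "1 \<le> k \<Longrightarrow> \<rho> k \<in> carrier SB"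
  unfolding \<rho>_def by (rule sphere_class_closed) auto

lemma set_circuit_subset: "1 \<le> k \<Longrightarrow> k \<le> m \<Longrightarrow> set (circuit m k) \<subseteq> {1..m}"
  using set_circuit[of k m] by auto

lemma \<rho>_next:
  assumes "1 \<le> k" "k \<le> m"
  shows "sphere_class [k] \<cdot> \<rho> k \<cdot> sphere_class (circuit m k) = \<rho> (Suc k)"
proof -
  have sub: "set [k..<Suc m] \<subseteq> {1..m}" "set [Suc k..<Suc m] \<subseteq> {1..m}" "set [k] \<subseteq> {1..m}"
    using assms by auto
  note c = set_circuit_subset[OF assms] set_circuit_Suc[of k]
  have "sphere_class [k] \<cdot> \<rho> k \<cdot> sphere_class (circuit m k) = sphere_class ([k] @ [k..<Suc m] @ circuit m k)"
    unfolding \<rho>_def using sub c by (subst sphere_class_append, auto simp: S.m_assoc sphere_class_append simp del: append.simps upt_Suc)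
  also have "\<dots> = sphere_class (circuit (Suc m) k @ [Suc k..<Suc m])"
    by (rule sphere_class_braid_eq[OF circuit_next[OF assms]]) (use sub c in auto)
  also have "\<dots> = \<rho> (Suc k)"
    unfolding \<rho>_def using sub c assms sphere_class_circuit[of k] sphere_class_append[of "circuit (Suc m) k" "[Suc k..<Suc m]"]
    by (simp del: upt_Suc)
  finally show ?thesis .
qed

lemma set_all_circuits_subset: "set (all_circuits m) \<subseteq> {1..m}"
  using set_all_circuits[of m] by auto

text \<open>By \<open>\<rho>_next\<close> each circuit carries \<open>\<rho> k\<close> to \<open>\<rho> (Suc k)\<close> up to one generator on the left. Multiplying all of them telescopes to the
cyclic rotation \<open>circuit (Suc m) (Suc m)\<close> of the sphere relation.\<close>

lemma sphere_class_all_circuits: "sphere_class (all_circuits m) = \<one>\<^bsub>SB\<^esub>"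
proof -
  let ?c = "\<lambda>j. concat (map (circuit m) [1..<Suc j])"
  have c: "set (?c j) \<subseteq> {1..m}" if "j \<le> m" for j
    using that set_circuit_subset by (fastforce simp del: upt_Suc)
  have "sphere_class (rev [1..<Suc j]) \<cdot> \<rho> 1 \<cdot> sphere_class (?c j) = \<rho> (Suc j)" if "j \<le> m" for j
    using that
  proof (induction j)
    case 0
    then show ?case by (simp add: sphere_class_Nil flip: One_nat_def)
  next
    case (Suc j)
    have sub: "set (rev [1..<Suc j]) \<subseteq> {1..m}" "set [Suc j] \<subseteq> {1..m}"
      "set (?c j) \<subseteq> {1..m}" "set (circuit m (Suc j)) \<subseteq> {1..m}"
      using Suc.prems c[of j] set_circuit_subset[of "Suc j"] by auto
    have "rev [1..<Suc (Suc j)] = [Suc j] @ rev [1..<Suc j]" "?c (Suc j) = ?c j @ circuit m (Suc j)"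
      by simp_all
    then have "sphere_class (rev [1..<Suc (Suc j)]) \<cdot> \<rho> 1 \<cdot> sphere_class (?c (Suc j))
        = sphere_class [Suc j] \<cdot> (sphere_class (rev [1..<Suc j]) \<cdot> \<rho> 1 \<cdot> sphere_class (?c j)) \<cdot> sphere_class (circuit m (Suc j))"
      using sub by (simp add: sphere_class_append S.m_assoc del: upt_Suc append.simps)
    then show ?case using Suc \<rho>_next[of "Suc j"] by simp
  qed
  from this[of m] have "sphere_class (rev [1..<Suc m]) \<cdot> \<rho> 1 \<cdot> sphere_class (all_circuits m) = \<one>\<^bsub>SB\<^esub>"
    by (simp add: all_circuits_def \<rho>_def sphere_class_Nil del: upt_Suc)
  moreover have "sphere_class (rev [1..<Suc m]) \<cdot> \<rho> 1 = \<one>\<^bsub>SB\<^esub>"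
    using sphere_class_circuit[of "Suc m"] sphere_class_append[of "rev [1..<Suc m]" "[1..<Suc m]"]
    by (simp add: circuit_def \<rho>_def atLeastLessThanSuc_atLeastAtMost del: upt_Suc)
  ultimately show ?thesis using set_all_circuits_subset by simp
qed

text \<open>A planar braid of the first \<open>m\<close> strings is a sphere braid, and by the preceding lemma \<open>\<Phi>\<close> is sent to \<open>1\<close>.\<close>

lemma planar_hom:
  obtains \<psi> where "\<psi> \<in> hom PQ SB" "\<And>u. set u \<subseteq> {1..<m} \<Longrightarrow> \<psi> (planar_class m u) = sphere_class u"
proof -
  let ?f = "\<lambda>i. sphere_class [i]"
  have ev: "eval_word SB ?f (pos_word u) = sphere_class u" if "set u \<subseteq> {1..m}" for u
    using eval_pos_class[OF that, of relS] by (simp add: SB_eq)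
  obtain \<psi> where "\<psi> \<in> hom (presented_group {1..<m} (circuit_relations m)) SB"
    and \<psi>: "\<And>w. w \<in> words {1..<m} \<Longrightarrow>
      \<psi> (pres_rel {1..<m} (circuit_relations m) `` {w}) = eval_word SB ?f w"
  proof (rule presented_group_universal[OF S.is_group, where f = ?f])
    fix i assume "i \<in> {1..<m}"
    then show "?f i \<in> carrier SB" by simp
  next
    fix u v assume uv: "(u, v) \<in> circuit_relations m" "u \<in> words {1..<m}" "v \<in> words {1..<m}"
    have "br [i, j] = br [j, i]" if "far i j" for i j using s_far[OF that] by (simp add: br_Cons)
    moreover have "br [i, Suc i, i] = br [Suc i, i, Suc i]" for i
      using s_adj[of i "Suc i"] by (simp add: br_Cons adj_def)
    ultimately consider u' v' where "u = pos_word u'" "v = pos_word v'" "br u' = br v'"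
      | "u = pos_word (all_circuits m)" "v = pos_word []"
      using uv(1) unfolding circuit_relations_def by fastforce
    then show "eval_word SB ?f u = eval_word SB ?f v"
    proof cases
      case 1
      then have "set u' \<subseteq> {1..<m}" "set v' \<subseteq> {1..<m}" using uv by simp_all
      then have "set u' \<subseteq> {1..m}" "set v' \<subseteq> {1..m}" by fastforce+
      then show ?thesis using 1 ev sphere_class_braid_eq by metis
    next
      case 2
      then show ?thesis using ev[OF set_all_circuits_subset] ev[of "[]"] sphere_class_all_circuits sphere_class_Nil by simp
    qed
  qed blast
  then have "\<psi> (planar_class m u) = sphere_class u" if "set u \<subseteq> {1..<m}" for u
  proof -
    have "set u \<subseteq> {1..m}" using that by fastforce
    then show ?thesis using \<psi>[of "pos_word u"] that ev by (simp add: pos_class_def)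
  qed
  then show ?thesis using that \<open>\<psi> \<in> _\<close> by (simp add: planar_quotient_def)
qed

section \<open>The action on marked positions\<close>

definition Z :: "nat \<Rightarrow> nat word set" where "Z i = planar_class m [i]"
text \<open>If the marked string at position \<open>i\<close> moves to \<open>i + 1\<close> and back through \<open>\<sigma>\<^sub>i\<^sup>2\<close>, another string has run around it. On the sphere
this is the same as that string running the other way around all the remaining ones.\<close>

definition D :: "nat \<Rightarrow> nat word set" where "D i = inv\<^bsub>PQ\<^esub> (planar_class m (circuit m i))"

lemma Z_closed [simp]: "1 \<le> i \<Longrightarrow> i < m \<Longrightarrow> Z i \<in> carrier PQ"
  by (simp add: Z_def planar_class_closed)

lemma circuit_closed [simp]: "1 \<le> i \<Longrightarrow> i \<le> m \<Longrightarrow> planar_class m (circuit m i) \<in> carrier PQ"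
  by (simp add: planar_class_closed set_circuit)

lemma D_closed [simp]: "1 \<le> i \<Longrightarrow> i \<le> m \<Longrightarrow> D i \<in> carrier PQ"
  by (simp add: D_def)

lemma Z_far:
  assumes "far i j" "1 \<le> i" "i < m" "1 \<le> j" "j < m" "q \<in> carrier PQ"
  shows "Z i \<star> (Z j \<star> q) = Z j \<star> (Z i \<star> q)"
proof -
  have "planar_class m ([i] @ [j]) = planar_class m ([j] @ [i])"
    using s_far[OF assms(1)] assms by (intro planar_class_braid_eq) (auto simp: br_Cons)
  then have "Z i \<star> Z j = Z j \<star> Z i"
    unfolding Z_def using assms planar_class_append[of "[i]" m "[j]"] planar_class_append[of "[j]" m "[i]"] by auto
  then show ?thesis using assms by (simp flip: Q.m_assoc)
qed

lemma Z_braid: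
  assumes "1 \<le> i" "Suc i < m" "q \<in> carrier PQ"
  shows "Z i \<star> (Z (Suc i) \<star> (Z i \<star> q)) = Z (Suc i) \<star> (Z i \<star> (Z (Suc i) \<star> q))"
proof -
  have "planar_class m ([i] @ [Suc i] @ [i]) = planar_class m ([Suc i] @ [i] @ [Suc i])"
    using s_adj[of i "Suc i"] assms by (intro planar_class_braid_eq) (auto simp: br_Cons adj_def)
  moreover have "planar_class m ([i] @ [Suc i] @ [i]) = Z i \<star> (Z (Suc i) \<star> Z i)"
    unfolding Z_def using assms by (subst planar_class_append, simp, simp, subst planar_class_append) auto
  moreover have "planar_class m ([Suc i] @ [i] @ [Suc i]) = Z (Suc i) \<star> (Z i \<star> Z (Suc i))"
    unfolding Z_def using assms by (subst planar_class_append, simp, simp, subst planar_class_append) auto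
  ultimately have "Z i \<star> Z (Suc i) \<star> Z i = Z (Suc i) \<star> Z i \<star> Z (Suc i)"
    using assms by (simp add: Q.m_assoc)
  then show ?thesis using assms by (simp flip: Q.m_assoc)
qed

lemma D_Z:
  assumes "1 \<le> k" "k \<le> m" "1 \<le> i" "i < m" "i \<noteq> k" "Suc i \<noteq> k" "q \<in> carrier PQ"
  shows "D k \<star> (Z i \<star> q) = Z i \<star> (D k \<star> q)"
proof -
  have "planar_class m (circuit m k @ [i]) = planar_class m ([i] @ circuit m k)"
    using circuit_commute[OF assms(1-6)] set_circuit[OF assms(1,2)] assms
    by (intro planar_class_braid_eq) (auto simp: br_append br_Cons)
  then have "planar_class m (circuit m k) \<star> Z i = Z i \<star> planar_class m (circuit m k)"
    unfolding Z_def using set_circuit[OF assms(1,2)] assms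
      planar_class_append[of "[i]" m "circuit m k"] planar_class_append[of "circuit m k" m "[i]"] by auto
  then have "D k \<star> Z i = Z i \<star> D k"
    unfolding D_def using assms by (intro Q.inv_intertwine) auto
  then show ?thesis using assms by (simp flip: Q.m_assoc)
qed

text \<open>Together with \<open>D_D_Z\<close> this is what the braid relations ask of the action when the marked string is one of
the three that move.\<close>

lemma D_Z_Suc:
  assumes "1 \<le> i" "i < m" "q \<in> carrier PQ"
  shows "D i \<star> (Z i \<star> q) = Z i \<star> (D (Suc i) \<star> q)"
proof -
  have set: "set (circuit m i) \<subseteq> {1..<m}" "set (circuit m (Suc i)) \<subseteq> {1..<m}"
    using set_circuit assms by auto
  have "planar_class m (circuit m i @ [i]) = planar_class m ([i] @ circuit m (Suc i))"
    using circuit_Suc[OF assms(1,2)] set assms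
    by (intro planar_class_braid_eq) (auto simp: br_append br_Cons)
  then have "planar_class m (circuit m i) \<star> Z i = Z i \<star> planar_class m (circuit m (Suc i))"
    unfolding Z_def using set assms
      planar_class_append[of "[i]" m "circuit m (Suc i)"] planar_class_append[of "circuit m i" m "[i]"] by auto
  then have "D i \<star> Z i = Z i \<star> D (Suc i)"
    unfolding D_def using assms by (intro Q.inv_intertwine) auto
  then show ?thesis using assms by (simp flip: Q.m_assoc)
qed

lemma D_D_Z:
  assumes "1 \<le> i" "i < m" "q \<in> carrier PQ"
  shows "D (Suc i) \<star> (D i \<star> (Z i \<star> q)) = Z i \<star> (D (Suc i) \<star> (D i \<star> q))"
proof -
  let ?c = "circuit m i @ circuit m (Suc i)"
  have set: "set (circuit m i) \<subseteq> {1..<m}" "set (circuit m (Suc i)) \<subseteq> {1..<m}" "set ?c \<subseteq> {1..<m}"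
    using set_circuit[of i m] set_circuit[of "Suc i" m] assms by auto
  have c: "planar_class m ?c = planar_class m (circuit m i) \<star> planar_class m (circuit m (Suc i))"
    using set by (simp add: planar_class_append)
  have "planar_class m (?c @ [i]) = planar_class m ([i] @ ?c)"
    using circuit_pair_commute[OF assms(1,2)] set assms
    by (intro planar_class_braid_eq) (auto simp: br_append br_Cons mult.assoc)
  then have "planar_class m ?c \<star> Z i = Z i \<star> planar_class m ?c"
    unfolding Z_def using set assms
      planar_class_append[of "[i]" m ?c] planar_class_append[of ?c m "[i]"] by auto
  then have "inv\<^bsub>PQ\<^esub> (planar_class m ?c) \<star> Z i = Z i \<star> inv\<^bsub>PQ\<^esub> (planar_class m ?c)"
    using assms set by (intro Q.inv_intertwine) (auto simp: planar_class_closed)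
  moreover have "inv\<^bsub>PQ\<^esub> (planar_class m ?c) = D (Suc i) \<star> D i"
    unfolding c D_def using assms by (simp add: Q.inv_mult_group)
  ultimately show ?thesis using assms by (simp flip: Q.m_assoc)
qed

definition swap :: "nat \<Rightarrow> nat \<Rightarrow> nat" where
  "swap i k = (if k = i then Suc i else if k = Suc i then i else k)"

text \<open>What \<open>\<sigma>\<^sub>i\<close> does to the other strings while the marked one is at position \<open>k\<close>: these strings are
renumbered without the marked one, which lowers the index \<open>i\<close> when \<open>k < i\<close>. Of the two ways in which \<open>\<sigma>\<^sub>i\<close> can move the
marked string, the one towards lower positions costs nothing, by the choice of \<open>\<rho>\<close>.\<close>

definition cocycle :: "nat \<Rightarrow> nat \<Rightarrow> nat word set" where
  "cocycle i k = (if k = i then D i else if k = Suc i then \<one>\<^bsub>PQ\<^esub>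
     else if i < k then Z i else Z (i - 1))"

definition act :: "nat \<Rightarrow> nat \<times> nat word set \<Rightarrow> nat \<times> nat word set" where
  "act i = (\<lambda>(k, q). if i \<in> {1..m} \<and> k \<in> {1..Suc m} \<and> q \<in> carrier PQ
     then (swap i k, cocycle i k \<star> q) else (k, q))"

lemma swap_swap [simp]: "swap i (swap i k) = k"
  by (simp add: swap_def)

lemma swap_closed: "i \<in> {1..m} \<Longrightarrow> swap i k \<in> {1..Suc m} \<longleftrightarrow> k \<in> {1..Suc m}"
  by (auto simp: swap_def)

lemma cocycle_closed: "i \<in> {1..m} \<Longrightarrow> k \<in> {1..Suc m} \<Longrightarrow> cocycle i k \<in> carrier PQ"
  by (auto simp: cocycle_def)

definition unact :: "nat \<Rightarrow> nat \<times> nat word set \<Rightarrow> nat \<times> nat word set" where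
  "unact i = (\<lambda>(k, q). if i \<in> {1..m} \<and> k \<in> {1..Suc m} \<and> q \<in> carrier PQ
     then (swap i k, inv\<^bsub>PQ\<^esub> (cocycle i (swap i k)) \<star> q) else (k, q))"

lemma unact_act: "unact i \<circ> act i = id" and act_unact: "act i \<circ> unact i = id"
proof -
  have "unact i (act i (k, q)) = (k, q) \<and> act i (unact i (k, q)) = (k, q)" for k q
  proof (cases "i \<in> {1..m} \<and> k \<in> {1..Suc m} \<and> q \<in> carrier PQ")
    case True
    then have "swap i k \<in> {1..Suc m}" "cocycle i k \<in> carrier PQ" "cocycle i (swap i k) \<in> carrier PQ"
      using swap_closed cocycle_closed by blast+
    with True show ?thesis
      by (simp add: act_def unact_def del: atLeastAtMost_iff flip: Q.m_assoc)
  qed (auto simp: act_def unact_def)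
  then show "unact i \<circ> act i = id" "act i \<circ> unact i = id" by (auto simp: fun_eq_iff)
qed

lemma bij_act: "bij (act i)" and bij_unact: "bij (unact i)"
  using o_bij unact_act act_unact by blast+

context
  fixes q assumes q [simp]: "q \<in> carrier PQ"
begin

lemma act_low: "1 \<le> i \<Longrightarrow> Suc i < k \<Longrightarrow> k \<le> Suc m \<Longrightarrow> act i (k, q) = (k, Z i \<star> q)"
  by (auto simp: act_def swap_def cocycle_def)

lemma act_high: "1 \<le> k \<Longrightarrow> k < i \<Longrightarrow> i \<le> m \<Longrightarrow> act i (k, q) = (k, Z (i - 1) \<star> q)"
  by (auto simp: act_def swap_def cocycle_def)

lemma act_down: "1 \<le> i \<Longrightarrow> i \<le> m \<Longrightarrow> act i (Suc i, q) = (i, q)"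
  by (auto simp: act_def swap_def cocycle_def)

lemma act_up: "1 \<le> i \<Longrightarrow> i \<le> m \<Longrightarrow> act i (i, q) = (Suc i, D i \<star> q)"
  by (auto simp: act_def swap_def cocycle_def)

end

lemma act_outside: "\<not> (k \<in> {1..Suc m} \<and> q \<in> carrier PQ) \<Longrightarrow> act i (k, q) = (k, q)"
  by (auto simp: act_def)

lemma act_commute_less:
  assumes "1 \<le> i" "i + 2 \<le> j" "j \<le> m" "k \<in> {1..Suc m}" "q \<in> carrier PQ"
  shows "act i (act j (k, q)) = act j (act i (k, q))"
proof -
  have j: "far i j" "far (i - 1) (j - 1)" using assms by (auto simp: far_def)
  consider "k < i" | "k = i" | "k = Suc i" | "Suc i < k" "k < j" | "k = j" | "k = Suc j" | "Suc j < k"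
    by linarith
  then show ?thesis
  proof cases
    case 4
    then have "far i (j - 1)" by (auto simp: far_def)
    then show ?thesis using 4 assms Z_far[of i "j - 1" q] by (simp add: act_low act_high)
  next
    case 1
    then show ?thesis using assms j Z_far[of "i - 1" "j - 1" q] by (simp add: act_high)
  next
    case 7
    then show ?thesis using assms j Z_far[of i j q] by (simp add: act_low)
  qed (use assms j in \<open>simp_all add: act_low act_high act_up act_down D_Z\<close>)
qed

lemma act_commute:
  assumes "far i j" "i \<in> {1..m}" "j \<in> {1..m}"
  shows "act i \<circ> act j = act j \<circ> act i"
proof
  fix x :: "nat \<times> nat word set"
  obtain k q where x: "x = (k, q)" by fastforce
  show "(act i \<circ> act j) x = (act j \<circ> act i) x"
  proof (cases "k \<in> {1..Suc m} \<and> q \<in> carrier PQ")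
    case True
    then show ?thesis
      using act_commute_less[of i j k q] act_commute_less[of j i k q] assms x by (auto simp: far_def)
  qed (simp add: x act_outside)
qed

lemma act_braid:
  assumes "1 \<le> i" "Suc i \<le> m"
  shows "act i \<circ> act (Suc i) \<circ> act i = act (Suc i) \<circ> act i \<circ> act (Suc i)"
proof
  fix x :: "nat \<times> nat word set"
  obtain k q where x: "x = (k, q)" by fastforce
  show "(act i \<circ> act (Suc i) \<circ> act i) x = (act (Suc i) \<circ> act i \<circ> act (Suc i)) x"
  proof (cases "k \<in> {1..Suc m} \<and> q \<in> carrier PQ")
    case True
    consider "k < i" | "k = i" | "k = Suc i" | "k = Suc (Suc i)" | "Suc (Suc i) < k" by linarith
    then show ?thesis
    proof cases
      case 1
      obtain i' where "i = Suc i'" "1 \<le> i'" using 1 True by (cases i) auto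
      then show ?thesis using 1 True assms Z_braid[of i' q] by (simp add: x act_high)
    next
      case 2
      then show ?thesis using True assms D_D_Z[of i q] by (simp add: x act_low act_high act_up)
    next
      case 3
      then show ?thesis using True assms by (simp add: x act_low act_high act_up act_down D_Z_Suc)
    next
      case 4
      then show ?thesis using True assms by (simp add: x act_low act_high act_down)
    next
      case 5
      then show ?thesis using True assms Z_braid[of i q] by (simp add: x act_low)
    qed
  qed (simp add: x act_outside)
qed

lemma foldr_act_low:
  assumes "k \<in> {1..Suc m}" "q \<in> carrier PQ" "\<And>i. i \<in> set u \<Longrightarrow> 1 \<le> i \<and> Suc i < k"
  shows "foldr act u (k, q) = (k, planar_class m u \<star> q)"
  using assms(3)
proof (induction u)
  case (Cons i u)
  have "i < m" "set u \<subseteq> {1..<m}" using Cons.prems[of i] Cons.prems assms(1) by force+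
  then have "planar_class m ([i] @ u) = Z i \<star> planar_class m u" "planar_class m u \<in> carrier PQ"
    using Cons.prems unfolding Z_def by (intro planar_class_append planar_class_closed; auto)+
  then show ?case using Cons assms \<open>i < m\<close> by (simp add: act_low Q.m_assoc)
qed (use assms in \<open>simp add: planar_class_Nil\<close>)

lemma foldr_act_high:
  assumes "1 \<le> k" "q \<in> carrier PQ" "\<And>i. i \<in> set u \<Longrightarrow> k \<le> i \<and> i < m"
  shows "foldr act (map Suc u) (k, q) = (k, planar_class m u \<star> q)"
  using assms(3)
proof (induction u)
  case (Cons i u)
  have i: "k \<le> i" "1 \<le> i" "i < m" using Cons.prems[of i] assms(1) by auto
  have u: "set u \<subseteq> {1..<m}" using Cons.prems assms(1) by force
  then have "planar_class m ([i] @ u) = Z i \<star> planar_class m u"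
    unfolding Z_def using i by (intro planar_class_append) auto
  moreover have "foldr act (map Suc u) (k, q) = (k, planar_class m u \<star> q)" using Cons by simp
  ultimately show ?case
    using planar_class_closed[OF u] i assms(1,2) act_high[of "planar_class m u \<star> q" k "Suc i"] by (simp add: Q.m_assoc)
qed (use assms in \<open>simp add: planar_class_Nil\<close>)

lemma foldr_act_down:
  assumes "1 \<le> a" "a \<le> b" "b \<le> Suc m" "q \<in> carrier PQ"
  shows "foldr act [a..<b] (b, q) = (a, q)"
  using assms(2,3)
proof (induction b rule: dec_induct)
  case (step b)
  then show ?case using assms by (simp add: act_down)
qed simp

lemma foldr_act_up:
  assumes "b \<le> m" "q \<in> carrier PQ"
  shows "foldr act (rev [1..<Suc b]) (1, q) =
    (Suc b, inv\<^bsub>PQ\<^esub> (planar_class m (concat (map (circuit m) [1..<Suc b]))) \<star> q)"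
  using assms(1)
proof (induction b)
  case 0
  then show ?case using assms by (simp add: planar_class_Nil flip: One_nat_def)
next
  case (Suc b)
  let ?c = "concat (map (circuit m) [1..<Suc b])"
  have c: "set ?c \<subseteq> {1..<m}" "set (circuit m (Suc b)) \<subseteq> {1..<m}"
  proof -
    have "set (circuit m k) \<subseteq> {1..<m}" if "k \<in> set [1..<Suc (Suc b)]" for k
      using that Suc.prems by (intro set_circuit) auto
    then show "set ?c \<subseteq> {1..<m}" "set (circuit m (Suc b)) \<subseteq> {1..<m}" by auto
  qed
  have "concat (map (circuit m) [1..<Suc (Suc b)]) = ?c @ circuit m (Suc b)" by simp
  then have "planar_class m (concat (map (circuit m) [1..<Suc (Suc b)])) = planar_class m ?c \<star> planar_class m (circuit m (Suc b))"
    using c by (simp only: planar_class_append)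
  then show ?case
    using Suc c assms planar_class_closed[OF c(1)] planar_class_closed[OF c(2)]
    by (simp add: act_up D_def Q.inv_mult_group Q.m_assoc)
qed

text \<open>If the marked string is the first one, it visits all positions and collects the inverse of every circuit, in
total the inverse of \<open>\<Phi>\<close>. If it is at position \<open>j + 1\<close>, the first string passes around it once, which gives the inverse of a circuit, and around all the
others, which gives the rotated circuit itself.\<close>

lemma foldr_act_sphere: "foldr act (circuit (Suc m) 1) = id"
proof
  fix x :: "nat \<times> nat word set"
  obtain k q where x: "x = (k, q)" by fastforce
  have w: "circuit (Suc m) 1 = [1..<Suc m] @ rev [1..<Suc m]" by (simp add: circuit_def del: upt_Suc)
  have outside: "foldr act u x = x" if "\<not> (k \<in> {1..Suc m} \<and> q \<in> carrier PQ)" for u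
    using that by (induction u) (simp_all add: x act_outside)
  show "foldr act (circuit (Suc m) 1) x = id x"
  proof (cases "k \<in> {1..Suc m} \<and> q \<in> carrier PQ")
    case False
    then show ?thesis by (simp add: outside)
  next
    case True
    then consider "k = 1" | j where "k = Suc j" "1 \<le> j" "j \<le> m" by (metis One_nat_def Suc_le_mono atLeastAtMost_iff le_SucE le_add1 not0_implies_Suc plus_1_eq_Suc le_zero_eq not_less_eq_eq zero_le)
    then show ?thesis
    proof cases
      case 1
      then show ?thesis
        using True foldr_act_up[of m q] foldr_act_down[of 1 "Suc m" q]
        by (simp add: w x planar_class_all_circuits flip: all_circuits_def del: upt_Suc)
    next
      case 2
      have split: "[1..<Suc m] = [1..<j] @ [j] @ map Suc [j..<m]"
        using 2 upt_add_eq_append[of 1 j "Suc m - j"] by (simp add: upt_conv_Cons map_Suc_upt del: upt_Suc)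
      let ?u = "[1..<j]" and ?v = "[j..<m] @ rev [j..<m] @ rev [1..<j]"
      have low: "foldr act ?u (Suc j, q') = (Suc j, planar_class m ?u \<star> q')"
        "foldr act (rev ?u) (Suc j, q') = (Suc j, planar_class m (rev ?u) \<star> q')"
        if "q' \<in> carrier PQ" for q'
        using that 2 by (intro foldr_act_low; auto)+
      have high: "foldr act (map Suc [j..<m]) (j, q') = (j, planar_class m [j..<m] \<star> q')"
        "foldr act (rev (map Suc [j..<m])) (j, q') = (j, planar_class m (rev [j..<m]) \<star> q')"
        if "q' \<in> carrier PQ" for q'
        unfolding rev_map using that 2 by (intro foldr_act_high; auto)+
      have sets: "set [1..<j] \<subseteq> {1..<m}" "set [j..<m] \<subseteq> {1..<m}" "set ?v \<subseteq> {1..<m}"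
        "set (rev [1..<j]) \<subseteq> {1..<m}" "set (rev [j..<m]) \<subseteq> {1..<m}" "set (rev [j..<m] @ rev [1..<j]) \<subseteq> {1..<m}"
        using 2 by auto
      note cl = sets[THEN planar_class_closed]
      have "circuit m j = ?v @ ?u"
        using 2 upt_add_eq_append[of 1 j "m - j"] by (simp add: circuit_def)
      then have D: "D j = inv\<^bsub>PQ\<^esub> (planar_class m ?u) \<star> inv\<^bsub>PQ\<^esub> (planar_class m ?v)"
        unfolding D_def using planar_class_append[OF sets(3,1)] cl by (simp add: Q.inv_mult_group)
      have v: "planar_class m ?v = planar_class m [j..<m] \<star> (planar_class m (rev [j..<m]) \<star> planar_class m (rev [1..<j]))"
        using planar_class_append[OF sets(2,6)] planar_class_append[OF sets(5,4)] by simp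
      have "foldr act (circuit (Suc m) 1) (k, q)
          = (k, planar_class m ?u \<star> (D j \<star> (planar_class m [j..<m] \<star> (planar_class m (rev [j..<m]) \<star> (planar_class m (rev [1..<j]) \<star> q)))))"
        unfolding w split using True 2 cl
        by (simp add: low high act_up act_down del: upt_Suc set_upt)
      also have "\<dots> = (k, planar_class m ?u \<star> (D j \<star> (planar_class m ?v \<star> q)))"
        unfolding v using True cl by (simp add: Q.m_assoc)
      also have "\<dots> = (k, (planar_class m ?u \<star> inv\<^bsub>PQ\<^esub> (planar_class m ?u)) \<star> ((inv\<^bsub>PQ\<^esub> (planar_class m ?v) \<star> planar_class m ?v) \<star> q))"
        unfolding D using True cl by (simp only: Q.m_assoc Q.m_closed Q.inv_closed)
      also have "\<dots> = (k, q)" using True cl by simp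
      finally show ?thesis by (simp add: x)
    qed
  qed
qed

end

context sphere_braids
begin

section \<open>Comparing the action with left multiplication\<close>

definition word_class :: "nat word \<Rightarrow> nat word set" where
  "word_class w = pres_rel {1..m} relS `` {w}"

lemma word_class_closed: "w \<in> words {1..m} \<Longrightarrow> word_class w \<in> carrier SB"
  by (simp add: word_class_def SB_eq presented_group_class_closed)

lemma word_class_pos_word: "word_class (pos_word u) = sphere_class u"
  by (simp add: word_class_def pos_class_def)

lemma word_class_append: "u \<in> words {1..m} \<Longrightarrow> v \<in> words {1..m} \<Longrightarrow> word_class (u @ v) = word_class u \<cdot> word_class v"
  by (simp add: word_class_def SB_eq presented_group_mult)

lemma word_class_inverse_letter:
  assumes "i \<in> {1..m}"
  shows "word_class [(i, False)] = inv\<^bsub>SB\<^esub> (sphere_class [i])"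
proof -
  have "([(i, False), (i, \<not> False)], []) \<in> pres_rel {1..m} relS"
    using assms by (rule pres_rel.cancel)
  then have "word_class ([(i, False)] @ [(i, True)]) = word_class []"
    using assms by (simp add: word_class_def pres_class_eq_iff)
  then have "word_class [(i, False)] \<cdot> sphere_class [i] = \<one>\<^bsub>SB\<^esub>"
    using assms word_class_append[of "[(i, False)]" "[(i, True)]"] word_class_pos_word[of "[i]"] word_class_pos_word[of "[]"]
    by (simp add: sphere_class_Nil)
  then show ?thesis
    using assms word_class_closed[of "[(i, False)]"] by (intro S.inv_equality[symmetric]) auto
qed

text \<open>This shows that \<open>cocycle\<close> is dictated by the sphere braid group: it corrects the product of a generator and a
coset representative.\<close>

lemma generator_\<rho>:
  assumes \<psi>: "\<psi> \<in> hom PQ SB" "\<And>u. set u \<subseteq> {1..<m} \<Longrightarrow> \<psi> (planar_class m u) = sphere_class u"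
    and i: "i \<in> {1..m}" and k: "k \<in> {1..Suc m}"
  shows "sphere_class [i] \<cdot> \<rho> k = \<rho> (swap i k) \<cdot> \<psi> (cocycle i k)"
proof -
  interpret \<psi>: group_hom PQ SB \<psi>
    using \<psi>(1) by (simp add: group_hom_def group_hom_axioms_def S.is_group Q.is_group)
  have sub: "set [k..<Suc m] \<subseteq> {1..m}" "set [i] \<subseteq> {1..m}" using i k by auto
  consider "k = i" | "k = Suc i" | "Suc i < k" | "k < i" by linarith
  then show ?thesis
  proof cases
    case 1
    have c: "sphere_class (circuit m i) \<in> carrier SB" using set_circuit_subset[of i] i by simp
    have "\<psi> (D i) = inv\<^bsub>SB\<^esub> (sphere_class (circuit m i))"
      unfolding D_def using i \<psi>(2)[OF set_circuit[of i m]] by simp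
    moreover have "\<rho> (Suc i) \<cdot> inv\<^bsub>SB\<^esub> (sphere_class (circuit m i)) = sphere_class [i] \<cdot> \<rho> i"
      using \<rho>_next[of i, symmetric] i c by (simp add: S.m_assoc)
    ultimately show ?thesis using 1 by (simp add: swap_def cocycle_def)
  next
    case 2
    have "[i..<Suc m] = [i] @ [k..<Suc m]" using i 2 by (simp add: upt_conv_Cons del: upt_Suc)
    then have "sphere_class [i] \<cdot> \<rho> k = \<rho> i" unfolding \<rho>_def using sub by (simp add: sphere_class_append del: upt_Suc append.simps)
    then show ?thesis using 2 i by (simp add: swap_def cocycle_def)
  next
    case 3
    have "br ([i] @ [k..<Suc m]) = br ([k..<Suc m] @ [i])"
      unfolding br_append s_eq[symmetric] using 3 by (intro s_br_far) (auto simp: far_def)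
    then have "sphere_class ([i] @ [k..<Suc m]) = sphere_class ([k..<Suc m] @ [i])"
      using sub by (intro sphere_class_braid_eq) auto
    then have "sphere_class [i] \<cdot> \<rho> k = \<rho> k \<cdot> sphere_class [i]" unfolding \<rho>_def using sub by (simp only: sphere_class_append)
    moreover have "\<psi> (Z i) = sphere_class [i]" unfolding Z_def using 3 i k by (intro \<psi>(2)) auto
    ultimately show ?thesis using 3 by (simp add: swap_def cocycle_def)
  next
    case 4
    then obtain j where j: "i = Suc j" "k \<le> j" by (cases i) auto
    have "br ([i] @ [k..<Suc m]) = br ([k..<Suc m] @ [j])"
      unfolding br_append s_eq[symmetric] using up_shift[of k j "Suc m"] j i by simp
    then have "sphere_class ([i] @ [k..<Suc m]) = sphere_class ([k..<Suc m] @ [j])"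
      using sub by (intro sphere_class_braid_eq) auto
    moreover have "set [j] \<subseteq> {1..m}" using j i k by simp
    ultimately have "sphere_class [i] \<cdot> \<rho> k = \<rho> k \<cdot> sphere_class [j]" unfolding \<rho>_def using sub by (simp only: sphere_class_append)
    moreover have "\<psi> (Z j) = sphere_class [j]" unfolding Z_def using j i k by (intro \<psi>(2)) auto
    ultimately show ?thesis using 4 j by (simp add: swap_def cocycle_def)
  qed
qed

abbreviation act_word :: "nat word \<Rightarrow> nat \<times> nat word set \<Rightarrow> nat \<times> nat word set" where
  "act_word \<equiv> eval_word bijections act"

lemma act_word_pos_word: "act_word (pos_word u) = foldr act u"
  by (induction u) auto

lemma inv_act: "inv\<^bsub>bijections\<^esub> (act i) = unact i"
  by (rule inv_bijections[OF unact_act bij_act bij_unact])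

text \<open>The map \<open>\<phi>\<close> permutes the positions by \<open>\<tau>\<close> and multiplies the planar part by \<open>c\<close> from the left, and left multiplication by
\<open>g\<close> does the same to the sphere braids \<open>\<rho> k \<cdot> \<psi> q\<close>.\<close>

definition acts_as :: "(nat word set \<Rightarrow> nat word set) \<Rightarrow> nat word set \<Rightarrow>
    (nat \<times> nat word set \<Rightarrow> nat \<times> nat word set) \<Rightarrow> (nat \<Rightarrow> nat) \<Rightarrow> (nat \<Rightarrow> nat word set) \<Rightarrow> bool" where
  "acts_as \<psi> g \<phi> \<tau> c \<longleftrightarrow> (\<forall>k\<in>{1..Suc m}. \<tau> k \<in> {1..Suc m} \<and> c k \<in> carrier PQ \<and>
     g \<cdot> \<rho> k = \<rho> (\<tau> k) \<cdot> \<psi> (c k) \<and> (\<forall>q\<in>carrier PQ. \<phi> (k, q) = (\<tau> k, c k \<star> q)))"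

lemma acts_as_letter:
  assumes \<psi>: "\<psi> \<in> hom PQ SB" "\<And>u. set u \<subseteq> {1..<m} \<Longrightarrow> \<psi> (planar_class m u) = sphere_class u"
    and i: "i \<in> {1..m}"
  shows "\<exists>\<tau> c. acts_as \<psi> (word_class [(i, b)]) (act_word [(i, b)]) \<tau> c"
proof -
  interpret \<psi>: group_hom PQ SB \<psi>
    using \<psi>(1) by (simp add: group_hom_def group_hom_axioms_def S.is_group Q.is_group)
  have gen: "sphere_class [i] \<cdot> \<rho> k = \<rho> (swap i k) \<cdot> \<psi> (cocycle i k)" if "k \<in> {1..Suc m}" for k
    using generator_\<rho> \<psi> i that by blast
  show ?thesis
  proof (cases b)
    case True
    have "acts_as \<psi> (word_class [(i, b)]) (act_word [(i, b)]) (swap i) (cocycle i)"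
      unfolding acts_as_def using True i gen swap_closed[OF i] cocycle_closed[OF i] word_class_pos_word[of "[i]"]
      by (auto simp: act_def simp del: atLeastAtMost_iff)
    then show ?thesis by blast
  next
    case False
    have "acts_as \<psi> (word_class [(i, b)]) (act_word [(i, b)]) (swap i) (\<lambda>k. inv\<^bsub>PQ\<^esub> (cocycle i (swap i k)))"
      unfolding acts_as_def
    proof (intro ballI conjI)
      fix k assume k: "k \<in> {1..Suc m}"
      have k': "swap i k \<in> {1..Suc m}" and c: "cocycle i (swap i k) \<in> carrier PQ"
        using swap_closed[OF i] cocycle_closed[OF i] k by blast+
      show "swap i k \<in> {1..Suc m}" "inv\<^bsub>PQ\<^esub> (cocycle i (swap i k)) \<in> carrier PQ" using k' c by auto
      have eq: "sphere_class [i] \<cdot> \<rho> (swap i k) = \<rho> k \<cdot> \<psi> (cocycle i (swap i k))" using gen[OF k'] by simp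
      have cl: "sphere_class [i] \<in> carrier SB" "\<rho> (swap i k) \<in> carrier SB" "\<rho> k \<in> carrier SB"
        "\<psi> (cocycle i (swap i k)) \<in> carrier SB"
        using i k k' c by auto
      have "inv\<^bsub>SB\<^esub> (sphere_class [i]) \<cdot> \<rho> k
          = inv\<^bsub>SB\<^esub> (sphere_class [i]) \<cdot> (\<rho> k \<cdot> \<psi> (cocycle i (swap i k))) \<cdot> inv\<^bsub>SB\<^esub> (\<psi> (cocycle i (swap i k)))"
        using cl by (simp add: S.m_assoc)
      also have "\<dots> = \<rho> (swap i k) \<cdot> inv\<^bsub>SB\<^esub> (\<psi> (cocycle i (swap i k)))"
        unfolding eq[symmetric] using cl by (simp add: S.m_assoc[symmetric])
      finally show "word_class [(i, b)] \<cdot> \<rho> k = \<rho> (swap i k) \<cdot> \<psi> (inv\<^bsub>PQ\<^esub> (cocycle i (swap i k)))"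
        using False c by (simp add: word_class_inverse_letter[OF i])
      fix q assume "q \<in> carrier PQ"
      then show "act_word [(i, b)] (k, q) = (swap i k, inv\<^bsub>PQ\<^esub> (cocycle i (swap i k)) \<star> q)"
        using False i k by (simp add: inv_act unact_def)
    qed
    then show ?thesis by blast
  qed
qed

lemma acts_as_word:
  assumes \<psi>: "\<psi> \<in> hom PQ SB" "\<And>u. set u \<subseteq> {1..<m} \<Longrightarrow> \<psi> (planar_class m u) = sphere_class u"
    and "w \<in> words {1..m}"
  shows "\<exists>\<tau> c. acts_as \<psi> (word_class w) (act_word w) \<tau> c"
  using assms(3)
proof (induction w)
  case Nil
  have "acts_as \<psi> (word_class []) (act_word []) (\<lambda>k. k) (\<lambda>_. \<one>\<^bsub>PQ\<^esub>)"
    using word_class_pos_word[of "[]"] hom_one[OF \<psi>(1) Q.is_group S.is_group]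
    by (auto simp: acts_as_def sphere_class_Nil)
  then show ?case by blast
next
  case (Cons a w)
  interpret \<psi>: group_hom PQ SB \<psi>
    using \<psi>(1) by (simp add: group_hom_def group_hom_axioms_def S.is_group Q.is_group)
  obtain i b where a: "a = (i, b)" by fastforce
  have i: "i \<in> {1..m}" and w: "w \<in> words {1..m}" "[a] \<in> words {1..m}" using Cons.prems a by auto
  obtain \<tau> c where 1: "acts_as \<psi> (word_class [a]) (act_word [a]) \<tau> c"
    using acts_as_letter[OF \<psi> i] a by blast
  obtain \<tau>' c' where 2: "acts_as \<psi> (word_class w) (act_word w) \<tau>' c'" using Cons.IH w by blast
  have W: "word_class (a # w) = word_class [a] \<cdot> word_class w" using word_class_append[OF w(2,1)] by simp
  have A: "act_word (a # w) x = act_word [a] (act_word w x)" for x by (cases a) simp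
  have "acts_as \<psi> (word_class (a # w)) (act_word (a # w)) (\<lambda>k. \<tau> (\<tau>' k)) (\<lambda>k. c (\<tau>' k) \<star> c' k)"
    unfolding acts_as_def
  proof (intro ballI conjI)
    fix k assume k: "k \<in> {1..Suc m}"
    have k': "\<tau>' k \<in> {1..Suc m}" "c' k \<in> carrier PQ" "word_class w \<cdot> \<rho> k = \<rho> (\<tau>' k) \<cdot> \<psi> (c' k)"
      "\<And>q. q \<in> carrier PQ \<Longrightarrow> act_word w (k, q) = (\<tau>' k, c' k \<star> q)"
      using 2 k unfolding acts_as_def by blast+
    then have k'': "\<tau> (\<tau>' k) \<in> {1..Suc m}" "c (\<tau>' k) \<in> carrier PQ"
      "word_class [a] \<cdot> \<rho> (\<tau>' k) = \<rho> (\<tau> (\<tau>' k)) \<cdot> \<psi> (c (\<tau>' k))"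
      "\<And>q. q \<in> carrier PQ \<Longrightarrow> act_word [a] (\<tau>' k, q) = (\<tau> (\<tau>' k), c (\<tau>' k) \<star> q)"
      using 1 unfolding acts_as_def by blast+
    show "\<tau> (\<tau>' k) \<in> {1..Suc m}" "c (\<tau>' k) \<star> c' k \<in> carrier PQ" using k' k'' by simp_all
    have cl: "word_class [a] \<in> carrier SB" "word_class w \<in> carrier SB" "\<rho> k \<in> carrier SB"
      "\<rho> (\<tau>' k) \<in> carrier SB" "\<rho> (\<tau> (\<tau>' k)) \<in> carrier SB"
      using w word_class_closed k k' k'' by auto
    have "word_class (a # w) \<cdot> \<rho> k = word_class [a] \<cdot> (word_class w \<cdot> \<rho> k)" unfolding W using cl by (simp add: S.m_assoc)
    also have "\<dots> = (word_class [a] \<cdot> \<rho> (\<tau>' k)) \<cdot> \<psi> (c' k)"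
      unfolding k'(3) using cl k'(2) by (simp add: S.m_assoc)
    also have "\<dots> = \<rho> (\<tau> (\<tau>' k)) \<cdot> \<psi> (c (\<tau>' k) \<star> c' k)"
      unfolding k''(3) using cl k'(2) k''(2) by (simp add: S.m_assoc)
    finally show "word_class (a # w) \<cdot> \<rho> k = \<rho> (\<tau> (\<tau>' k)) \<cdot> \<psi> (c (\<tau>' k) \<star> c' k)" .
    fix q assume "q \<in> carrier PQ"
    then show "act_word (a # w) (k, q) = (\<tau> (\<tau>' k), c (\<tau>' k) \<star> c' k \<star> q)"
      unfolding A using k'(2,4) k''(2,4) by (simp add: Q.m_assoc)
  qed
  then show ?case by blast
qed

text \<open>The last property makes the action faithful: if \<open>h g\<close> fixes a pair \<open>(k, q)\<close>, then \<open>g \<cdot> \<rho> k = \<rho> k\<close>.\<close>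

lemma sphere_action:
  obtains \<psi> h where "h \<in> hom SB bijections" "\<And>u. set u \<subseteq> {1..m} \<Longrightarrow> h (sphere_class u) = foldr act u"
    "\<And>g. g \<in> carrier SB \<Longrightarrow> \<exists>\<tau> c. acts_as \<psi> g (h g) \<tau> c" "\<psi> \<in> hom PQ SB"
proof -
  obtain h where h: "h \<in> hom (presented_group {1..m} relS) bijections"
    "\<And>w. w \<in> words {1..m} \<Longrightarrow> h (pres_rel {1..m} relS `` {w}) = act_word w"
  proof (rule presented_group_universal[OF group_bijections, where f = act])
    fix i assume "i \<in> {1..m}"
    then show "act i \<in> carrier bijections" by (simp add: bij_act)
  next
    fix u v assume uv: "(u, v) \<in> relS" "u \<in> words {1..m}" "v \<in> words {1..m}"
    then consider i j where "u = pos_word [i, j]" "v = pos_word [j, i]" "far i j" "i \<in> {1..m}" "j \<in> {1..m}"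
      | i where "u = pos_word [i, Suc i, i]" "v = pos_word [Suc i, i, Suc i]" "1 \<le> i" "Suc i \<le> m"
      | "u = pos_word (circuit (Suc m) 1)" "v = pos_word []"
      unfolding sphere_braid_relations_def sphere_word far_def by fastforce
    then show "act_word u = act_word v"
    proof cases
      case 1
      then show ?thesis using act_commute[of i j] unfolding act_word_pos_word by simp
    next
      case 2
      then show ?thesis using act_braid[of i] unfolding act_word_pos_word by (simp add: comp_assoc)
    next
      case 3
      show ?thesis unfolding 3 act_word_pos_word foldr_act_sphere by simp
    qed
  qed blast
  obtain \<psi> where \<psi>: "\<psi> \<in> hom PQ SB" "\<And>u. set u \<subseteq> {1..<m} \<Longrightarrow> \<psi> (planar_class m u) = sphere_class u"
    using planar_hom by blast
  show ?thesis
  proof (rule that)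
    show "h \<in> hom SB bijections" using h(1) by (simp add: SB_eq)
    show "h (sphere_class u) = foldr act u" if "set u \<subseteq> {1..m}" for u
      using h(2)[of "pos_word u"] that by (simp add: pos_class_def act_word_pos_word)
    show "\<exists>\<tau> c. acts_as \<psi> g (h g) \<tau> c" if "g \<in> carrier SB" for g
    proof -
      obtain w where w: "w \<in> words {1..m}" "g = word_class w"
        using \<open>g \<in> carrier SB\<close> unfolding SB_eq word_class_def by (rule presented_group_carrier_cases)
      then show ?thesis using acts_as_word[OF \<psi> w(1)] h(2)[OF w(1)] by (simp add: word_class_def)
    qed
  qed (rule \<psi>(1))
qed

section \<open>Odd numbers of strings\<close>

text \<open>The number \<open>Suc m\<close> of positions is odd, so some position \<open>k\<close> is fixed by both generators, whose planar parts at
\<open>k\<close> form a quaternion pair modulo \<open>\<Phi>\<close>. The square of the first part is trivial, and faithfulness kills \<open>x \<cdot> x\<close>.\<close>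

lemma no_quaternion_subgroup:
  assumes "even m"
  shows "\<not> contains_copy_of SB Q8"
proof
  assume "contains_copy_of SB Q8"
  then obtain x y where xy: "x \<in> carrier SB" "y \<in> carrier SB" "x \<cdot> x = y \<cdot> y" "x \<cdot> y \<cdot> x = y"
    "x \<cdot> x \<noteq> \<one>\<^bsub>SB\<^esub>" by (rule S.contains_Q8E)
  have four: "x \<cdot> x \<cdot> (x \<cdot> x) = \<one>\<^bsub>SB\<^esub>" using S.square_of_quaternion_pair xy by blast
  obtain \<psi> h where h: "h \<in> hom SB bijections"
    and ex: "\<And>g. g \<in> carrier SB \<Longrightarrow> \<exists>\<tau> c. acts_as \<psi> g (h g) \<tau> c" and \<psi>: "\<psi> \<in> hom PQ SB"
    using sphere_action by metis
  interpret h: group_hom SB bijections h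
    using h by (simp add: group_hom_def group_hom_axioms_def S.is_group group_bijections)
  obtain \<tau> c where 1: "acts_as \<psi> x (h x) \<tau> c" using ex xy by blast
  obtain \<tau>' c' where 2: "acts_as \<psi> y (h y) \<tau>' c'" using ex xy by blast
  have X: "\<tau> k \<in> {1..Suc m}" "c k \<in> carrier PQ" "x \<cdot> \<rho> k = \<rho> (\<tau> k) \<cdot> \<psi> (c k)"
    "\<And>q. q \<in> carrier PQ \<Longrightarrow> h x (k, q) = (\<tau> k, c k \<star> q)" if "k \<in> {1..Suc m}" for k
    using 1 that unfolding acts_as_def by blast+
  have Y: "\<tau>' k \<in> {1..Suc m}" "c' k \<in> carrier PQ"
    "\<And>q. q \<in> carrier PQ \<Longrightarrow> h y (k, q) = (\<tau>' k, c' k \<star> q)" if "k \<in> {1..Suc m}" for k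
    using 2 that unfolding acts_as_def by blast+
  have hxx: "h x \<circ> h x = h y \<circ> h y" using xy h.hom_mult by (metis bijections_simps(2))
  have hxyx: "h x \<circ> h y \<circ> h x = h y" using xy h.hom_mult S.m_closed by (metis bijections_simps(2))
  have hx4: "h x \<circ> h x \<circ> (h x \<circ> h x) = id"
    using xy four h.hom_mult h.hom_one S.m_closed by (metis bijections_simps(2,3))
  obtain k where k: "k \<in> {1..Suc m}" "\<tau> k = k" "\<tau>' k = k"
  proof (rule quaternion_common_fixed_point[of "{1..Suc m}" \<tau> \<tau>'])
    fix k assume k: "k \<in> {1..Suc m}"
    let ?k = "(k, \<one>\<^bsub>PQ\<^esub>)"
    show "\<tau> (\<tau> (\<tau> (\<tau> k))) = k"
      using fun_cong[OF hx4, of ?k] k X by simp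
    show "\<tau> (\<tau> k) = \<tau>' (\<tau>' k)"
      using fun_cong[OF hxx, of ?k] k X Y by simp
    show "\<tau> (\<tau>' (\<tau> k)) = \<tau>' k"
      using fun_cong[OF hxyx, of ?k] k X Y by simp
  qed (use assms X Y in auto)
  have cl: "c k \<in> carrier PQ" "c' k \<in> carrier PQ" using X Y k by auto
  have "c k \<star> c' k \<star> c k = c' k"
    using fun_cong[OF hxyx, of "(k, \<one>\<^bsub>PQ\<^esub>)"] k X[OF k(1)] Y[OF k(1)] by (simp add: Q.m_assoc)
  moreover have "c k \<star> c k \<star> (c k \<star> c k) = \<one>\<^bsub>PQ\<^esub>"
    using fun_cong[OF hx4, of "(k, \<one>\<^bsub>PQ\<^esub>)"] k X[OF k(1)] by (simp add: Q.m_assoc)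
  ultimately have "c k \<star> c k = \<one>\<^bsub>PQ\<^esub>"
    using planar_quotient_quaternion_pair[OF m cl] by blast
  then have \<psi>cc: "\<psi> (c k) \<cdot> \<psi> (c k) = \<one>\<^bsub>SB\<^esub>"
    using hom_mult[OF \<psi> cl(1) cl(1)] hom_one[OF \<psi> Q.is_group S.is_group] by simp
  have \<psi>c: "\<psi> (c k) \<in> carrier SB" and \<rho>: "\<rho> k \<in> carrier SB"
    using hom_in_carrier[OF \<psi> cl(1)] k by auto
  have x\<rho>: "x \<cdot> \<rho> k = \<rho> k \<cdot> \<psi> (c k)" using X(3)[OF k(1)] k(2) by simp
  have "x \<cdot> x \<cdot> \<rho> k = x \<cdot> (x \<cdot> \<rho> k)" using xy(1) \<rho> by (simp add: S.m_assoc)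
  also have "\<dots> = x \<cdot> (\<rho> k \<cdot> \<psi> (c k))" by (simp only: x\<rho>)
  also have "\<dots> = x \<cdot> \<rho> k \<cdot> \<psi> (c k)"
    using xy(1) \<psi>c \<rho> by (simp add: S.m_assoc)
  also have "\<dots> = \<rho> k \<cdot> (\<psi> (c k) \<cdot> \<psi> (c k))"
    unfolding x\<rho> using \<psi>c \<rho> by (simp add: S.m_assoc)
  finally have "x \<cdot> x \<cdot> \<rho> k = \<rho> k" using \<rho> by (simp add: \<psi>cc)
  then have "x \<cdot> x = \<one>\<^bsub>SB\<^esub>" using S.r_cancel_one[of "\<rho> k" "x \<cdot> x"] xy(1) \<rho> by simp
  then show False using xy(5) by blast
qed

section \<open>Even numbers of strings\<close>

definition rotations :: "nat \<Rightarrow> nat list" where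
  "rotations j = concat (replicate j [1..<Suc m])"

lemma set_rotations: "set (rotations j) \<subseteq> {1..m}"
  by (auto simp: rotations_def)

lemma set_half_twist_Suc: "set (half_twist (Suc m)) \<subseteq> {1..m}"
  using set_half_twist[of "Suc m"] by (auto simp del: half_twist.simps)

lemma br_rotations: "br (rotations j) = up 1 (Suc m) ^ j"
  by (induction j) (simp_all add: rotations_def br_append del: upt_Suc)

text \<open>The sphere relation says that the reversed rotation is the inverse of the rotation.\<close>

lemma rotations_cancel: "sphere_class (rotations j @ concat (replicate j (rev [1..<Suc m]))) = \<one>\<^bsub>SB\<^esub>"
proof (induction j)
  case (Suc j)
  let ?u = "[1..<Suc m]" and ?w = "rotations j @ concat (replicate j (rev [1..<Suc m]))"
  have "br (concat (replicate (Suc j) (rev ?u))) = br (concat (replicate j (rev ?u)) @ rev ?u)"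
  proof -
    have "br (concat (replicate i (rev ?u))) = br (rev ?u) ^ i" for i
      by (induction i) (simp_all add: br_append del: upt_Suc)
    then show ?thesis by (simp only: br_append power_Suc2)
  qed
  then have "br (rotations (Suc j) @ concat (replicate (Suc j) (rev ?u))) = br (?u @ ?w @ rev ?u)"
    by (simp add: rotations_def br_append mult.assoc del: upt_Suc)
  moreover have w: "set ?w \<subseteq> {1..m}" "set ?u \<subseteq> {1..m}" "set (rev ?u) \<subseteq> {1..m}"
    using set_rotations by auto
  moreover have "set (concat (replicate (Suc j) (rev ?u))) \<subseteq> {1..m}" by auto
  ultimately have "sphere_class (rotations (Suc j) @ concat (replicate (Suc j) (rev ?u))) = sphere_class (?u @ ?w @ rev ?u)"
    using set_rotations[of "Suc j"] by (intro sphere_class_braid_eq) (simp_all del: upt_Suc replicate_Suc set_concat set_upt)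
  also have "\<dots> = sphere_class ?u \<cdot> (sphere_class ?w \<cdot> sphere_class (rev ?u))"
    using w by (subst sphere_class_append, simp, simp, subst sphere_class_append) simp_all
  also have "\<dots> = sphere_class ?u \<cdot> sphere_class (rev ?u)" using w Suc by simp
  also have "\<dots> = sphere_class (?u @ rev ?u)" using w by (simp only: sphere_class_append)
  also have "\<dots> = \<one>\<^bsub>SB\<^esub>" using sphere_class_circuit[of 1] by (simp add: circuit_def del: upt_Suc)
  finally show ?case .
qed (simp add: rotations_def sphere_class_Nil)

lemma half_twist_flips_rotations:
  "\<Delta> (Suc m) * br (rotations j) = br (concat (replicate j (rev [1..<Suc m]))) * \<Delta> (Suc m)"
proof (induction j)
  case (Suc j)
  have flip: "\<Delta> (Suc m) * br u = br (map (\<lambda>i. Suc m - i) u) * \<Delta> (Suc m)" if "set u \<subseteq> {1..m}" for u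
    using that
  proof (induction u)
    case (Cons i u)
    have "\<Delta> (Suc m) * br (i # u) = \<Delta> (Suc m) * \<sigma> i * br u"
      by (simp add: br_Cons mult.assoc del: half_twist.simps)
    also have "\<dots> = \<sigma> (Suc m - i) * (\<Delta> (Suc m) * br u)"
      using half_twist_flip[of i "Suc m"] Cons.prems by (simp add: mult.assoc del: half_twist.simps)
    finally show ?case using Cons by (simp add: br_Cons mult.assoc del: half_twist.simps)
  qed simp
  have "map (\<lambda>i. Suc m - i) [1..<Suc m] = rev [1..<Suc m]"
    by (rule nth_equalityI) (auto simp: rev_nth simp del: upt_Suc)
  then have D: "\<Delta> (Suc m) * up 1 (Suc m) = down 1 (Suc m) * \<Delta> (Suc m)"
    using flip[of "[1..<Suc m]"] by (simp del: half_twist.simps upt_Suc) (simp add: atLeastLessThanSuc_atLeastAtMost)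
  have "\<Delta> (Suc m) * br (rotations (Suc j)) = \<Delta> (Suc m) * up 1 (Suc m) * br (rotations j)"
    by (simp add: rotations_def br_append mult.assoc del: half_twist.simps upt_Suc)
  also have "\<dots> = down 1 (Suc m) * (\<Delta> (Suc m) * br (rotations j))"
    unfolding D by (simp only: mult.assoc)
  also have "\<dots> = br (concat (replicate (Suc j) (rev [1..<Suc m]))) * \<Delta> (Suc m)"
    unfolding Suc by (simp add: br_append mult.assoc del: half_twist.simps upt_Suc)
  finally show ?case .
qed (simp add: rotations_def del: half_twist.simps)

lemma quaternion_pair:
  assumes "Suc m = 2 * j"
  defines "x \<equiv> sphere_class (rotations j)" and "y \<equiv> sphere_class (half_twist (Suc m))"
  shows "x \<in> carrier SB" "y \<in> carrier SB" "x \<cdot> x = y \<cdot> y" "x \<cdot> y \<cdot> x = y" "x \<cdot> x \<noteq> \<one>\<^bsub>SB\<^esub>"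
proof -
  note sets = set_rotations[of j] set_half_twist_Suc
  show x: "x \<in> carrier SB" and y: "y \<in> carrier SB" unfolding x_def y_def using sets by simp_all
  have "br (rotations j @ rotations j) = br (half_twist (Suc m) @ half_twist (Suc m))"
    unfolding br_append br_rotations half_twist_square using assms by (simp add: mult_2 flip: power_add)
  then have "sphere_class (rotations j @ rotations j) = sphere_class (half_twist (Suc m) @ half_twist (Suc m))"
    using sets by (intro sphere_class_braid_eq) auto
  then show xx: "x \<cdot> x = y \<cdot> y" unfolding x_def y_def using sets by (simp only: sphere_class_append)
  let ?d = "concat (replicate j (rev [1..<Suc m]))"
  have d: "set ?d \<subseteq> {1..m}" by auto
  have "br (half_twist (Suc m) @ rotations j) = br (?d @ half_twist (Suc m))"
    unfolding br_append half_twist_flips_rotations by (rule HOL.refl)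
  then have "sphere_class (half_twist (Suc m) @ rotations j) = sphere_class (?d @ half_twist (Suc m))"
    using sets by (intro sphere_class_braid_eq) auto
  then have yx: "y \<cdot> x = sphere_class ?d \<cdot> y" unfolding x_def y_def using sets d by (simp only: sphere_class_append)
  have xd: "x \<cdot> sphere_class ?d = \<one>\<^bsub>SB\<^esub>"
    using rotations_cancel[of j] sphere_class_append[OF sets(1) d] by (simp add: x_def)
  have "x \<cdot> y \<cdot> x = x \<cdot> (y \<cdot> x)" using x y by (simp add: S.m_assoc)
  also have "\<dots> = (x \<cdot> sphere_class ?d) \<cdot> y" unfolding yx using x y d by (simp add: S.m_assoc)
  finally show "x \<cdot> y \<cdot> x = y" unfolding xd using y by simp
  show "x \<cdot> x \<noteq> \<one>\<^bsub>SB\<^esub>"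
  proof
    assume "x \<cdot> x = \<one>\<^bsub>SB\<^esub>"
    let ?t = "half_twist m @ half_twist m"
    have t: "set ?t \<subseteq> {1..<m}" "set ?t \<subseteq> {1..m}" using set_half_twist[of m] by auto
    have "br (half_twist (Suc m) @ half_twist (Suc m)) = br (?t @ circuit (Suc m) (Suc m))"
      unfolding br_append half_twist_square_Suc by (simp add: circuit_def br_append mult.assoc del: upt_Suc)
    then have "sphere_class (half_twist (Suc m) @ half_twist (Suc m)) = sphere_class (?t @ circuit (Suc m) (Suc m))"
      using sets by (intro sphere_class_braid_eq) auto
    then have "y \<cdot> y = sphere_class ?t \<cdot> sphere_class (circuit (Suc m) (Suc m))"
      unfolding y_def using sets t set_circuit_Suc[of "Suc m"] by (simp only: sphere_class_append)
    then have "sphere_class ?t = \<one>\<^bsub>SB\<^esub>"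
      using \<open>x \<cdot> x = \<one>\<^bsub>SB\<^esub>\<close> xx t sphere_class_circuit[of "Suc m"] by simp
    moreover obtain \<psi> h where h: "h \<in> hom SB bijections" "\<And>u. set u \<subseteq> {1..m} \<Longrightarrow> h (sphere_class u) = foldr act u"
      using sphere_action by metis
    ultimately have "foldr act ?t = id"
      using h(2)[OF t(2)] hom_one[OF h(1) S.is_group group_bijections] by simp
    then have "foldr act ?t (Suc m, \<one>\<^bsub>PQ\<^esub>) = (Suc m, \<one>\<^bsub>PQ\<^esub>)" by simp
    moreover have "foldr act ?t (Suc m, \<one>\<^bsub>PQ\<^esub>) = (Suc m, planar_class m ?t \<star> \<one>\<^bsub>PQ\<^esub>)"
      using t by (intro foldr_act_low) auto
    ultimately have "planar_class m ?t = \<one>\<^bsub>PQ\<^esub>" using planar_class_closed[OF t(1)] by simp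
    then show False using planar_class_half_twist_square[OF m] by blast
  qed
qed

text \<open>Modulo commutators the braid relation identifies neighbouring generators, and the sphere relation, a word of length
\<open>2 * m\<close>, then bounds the order of their common class.\<close>

lemma sphere_class_in_derived:
  assumes u: "set u \<subseteq> {1..m}" and "2 * m dvd length u"
  shows "sphere_class u \<in> derived SB (carrier SB)"
proof -
  let ?N = "derived SB (carrier SB)"
  interpret N: normal ?N SB by (rule S.derived_self_is_normal)
  interpret K: comm_group "SB Mod ?N" by (rule S.derived_quot_is_comm_group)
  let ?p = "\<lambda>g. ?N #>\<^bsub>SB\<^esub> g"
  interpret p: group_hom SB "SB Mod ?N" ?p
    using N.r_coset_hom_Mod by (simp add: group_hom_def group_hom_axioms_def S.is_group K.is_group)
  have Suc_eq: "?p (sphere_class [Suc i]) = ?p (sphere_class [i])" if i: "1 \<le> i" "Suc i \<le> m" for i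
  proof -
    let ?a = "?p (sphere_class [i])" and ?b = "?p (sphere_class [Suc i])"
    have sub: "set [i] \<subseteq> {1..m}" "set [Suc i] \<subseteq> {1..m}" using i by auto
    then have cl: "?a \<in> carrier (SB Mod ?N)" "?b \<in> carrier (SB Mod ?N)"
      using p.hom_closed sphere_class_closed by blast+
    have "sphere_class (([i] @ [Suc i]) @ [i]) = sphere_class (([Suc i] @ [i]) @ [Suc i])"
      using s_adj[of i "Suc i"] i by (intro sphere_class_braid_eq) (auto simp: br_Cons adj_def)
    then have "sphere_class [i] \<cdot> sphere_class [Suc i] \<cdot> sphere_class [i] = sphere_class [Suc i] \<cdot> sphere_class [i] \<cdot> sphere_class [Suc i]"
      using sub sphere_class_append[of "[i] @ [Suc i]" "[i]"] sphere_class_append[of "[Suc i] @ [i]" "[Suc i]"]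
        sphere_class_append[of "[i]" "[Suc i]"] sphere_class_append[of "[Suc i]" "[i]"] by (simp del: append.simps)
    then have "?p (sphere_class [i] \<cdot> sphere_class [Suc i] \<cdot> sphere_class [i]) = ?p (sphere_class [Suc i] \<cdot> sphere_class [i] \<cdot> sphere_class [Suc i])" by simp
    then have "?a \<otimes>\<^bsub>SB Mod ?N\<^esub> ?b \<otimes>\<^bsub>SB Mod ?N\<^esub> ?a = ?a \<otimes>\<^bsub>SB Mod ?N\<^esub> ?b \<otimes>\<^bsub>SB Mod ?N\<^esub> ?b"
      using sub K.m_comm[OF cl] by (simp only: p.hom_mult S.m_closed sphere_class_closed)
    then show ?thesis using K.Units_l_cancel[of "?a \<otimes>\<^bsub>SB Mod ?N\<^esub> ?b"] cl K.m_closed K.Units_eq by auto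
  qed
  have gen: "?p (sphere_class [i]) = ?p (sphere_class [1])" if "1 \<le> i" "i \<le> m" for i
    using that by (induction i rule: dec_induct) (simp_all add: Suc_eq)
  let ?t = "?p (sphere_class [1])"
  have t: "?t \<in> carrier (SB Mod ?N)" using m by (intro p.hom_closed sphere_class_closed) simp
  have pow: "?p (sphere_class u) = ?t [^]\<^bsub>SB Mod ?N\<^esub> length u" if "set u \<subseteq> {1..m}" for u
    using that
  proof (induction u)
    case Nil
    then show ?case using p.hom_one by (simp add: sphere_class_Nil)
  next
    case (Cons i u)
    have i: "set [i] \<subseteq> {1..m}" "set u \<subseteq> {1..m}" using Cons.prems by auto
    have "?p (sphere_class (i # u)) = ?p (sphere_class [i] \<cdot> sphere_class u)" using sphere_class_append[OF i] by simp
    also have "\<dots> = ?t \<otimes>\<^bsub>SB Mod ?N\<^esub> (?t [^]\<^bsub>SB Mod ?N\<^esub> length u)"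
      using i gen[of i] Cons.IH by (simp only: p.hom_mult sphere_class_closed) auto
    also have "\<dots> = ?t [^]\<^bsub>SB Mod ?N\<^esub> length (i # u)"
      using K.nat_pow_Suc2[OF t] by simp
    finally show ?case .
  qed
  have "?t [^]\<^bsub>SB Mod ?N\<^esub> (2 * m) = ?p (sphere_class (circuit (Suc m) 1))"
    using pow[OF set_circuit_Suc[of 1]] by (simp add: length_circuit)
  also have "\<dots> = \<one>\<^bsub>SB Mod ?N\<^esub>" using sphere_class_circuit[of 1] p.hom_one by simp
  finally have one: "?t [^]\<^bsub>SB Mod ?N\<^esub> (2 * m) = \<one>\<^bsub>SB Mod ?N\<^esub>" .
  obtain c where "length u = 2 * m * c" using assms(2) by (auto elim: dvdE)
  then have "?p (sphere_class u) = (?t [^]\<^bsub>SB Mod ?N\<^esub> (2 * m)) [^]\<^bsub>SB Mod ?N\<^esub> c"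
    using pow[OF u] K.nat_pow_pow[OF t] by simp
  then have "?p (sphere_class u) = ?N" unfolding one by (metis K.nat_pow_one one_FactGroup)
  then show ?thesis
    using S.coset_join1[OF _ _ N.is_subgroup] u N.subset by (metis sphere_class_closed)
qed

end

section \<open>The quaternion group in sphere braid groups\<close>

theorem mainTheorem1:
  fixes n :: nat
  assumes "n \<ge> 3"
  shows "(4 dvd n \<longrightarrow> contains_copy_of (commutator_subgroup (sphere_braid_group n)) Q8) \<and>
         ((\<exists>k. odd k \<and> n = 2 * k) \<longrightarrow> contains_copy_of (sphere_braid_group n) Q8) \<and>
         (odd n \<longrightarrow> \<not> contains_copy_of (sphere_braid_group n) Q8)"
proof -
  obtain m where n: "n = Suc m" and m: "2 \<le> m" using assms by (cases n) auto
  interpret sphere_braids m by unfold_locales (rule m)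
  have a: "contains_copy_of (commutator_subgroup SB) Q8" if four: "4 dvd Suc m"
  proof -
    obtain c where c: "Suc m = 4 * c" using four by (auto elim: dvdE)
    then have j: "Suc m = 2 * (2 * c)" by simp
    note pair = quaternion_pair[OF j]
    let ?x = "sphere_class (rotations (2 * c))" and ?y = "sphere_class (half_twist (Suc m))"
    have "length (rotations (2 * c)) = 2 * m * c"
      by (simp add: rotations_def length_concat sum_list_replicate del: upt_Suc)
    then have x: "?x \<in> derived SB (carrier SB)"
      using set_rotations by (intro sphere_class_in_derived) auto
    have "2 * length (half_twist (Suc m)) = 2 * (2 * m * c)"
      unfolding length_half_twist using c by simp
    then have "length (half_twist (Suc m)) = 2 * m * c" by linarith
    then have y: "?y \<in> derived SB (carrier SB)"
      using set_half_twist_Suc by (intro sphere_class_in_derived) (simp_all del: half_twist.simps)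
    show ?thesis
      by (rule group.contains_Q8I[OF S.group_commutator_subgroup, of ?x ?y])
        (use x y pair in \<open>simp_all add: commutator_subgroup_def\<close>)
  qed
  have b: "contains_copy_of SB Q8" if "Suc m = 2 * k" for k
    using S.contains_Q8I quaternion_pair[OF that] by blast
  show ?thesis using a b no_quaternion_subgroup n by auto
qed

end
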